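(* There is a polynomial-time algorithm that, given a double Horn formula $\varphi$ and a positive integer $k$, finds $k$ satisfying assignments $\alpha_1,\dots,\alpha_k$ of $\varphi$ (repetitions allowed) maximizing $\sum_{1\le i<j\le k}|\alpha_i\triangle\alpha_j|$ over all such $k$-tuples of satisfying assignments (or reports that $\varphi$ is unsatisfiable).
   Context: A double Horn formula is a CNF formula in which every clause contains at most one positive literal and at most one negative literal. For truth assignments $\alpha,\beta$ on a variable set $X$, $\alpha\triangle\beta=\{x\in X:\alpha(x)\neq\beta(x)\}$. *)

theory Defs
  imports "HOL-Computational_Algebra.Polynomial"
begin

section \<open>Double Horn formulas and diverse satisfying assignments\<close>

text \<open>
  A literal \<open>(x, b)\<close> is the variable \<open>x\<close> if \<open>b\<close> is true and its negation otherwise.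
  Clauses and formulas are lists because they are fed to a machine; their semantics depends
  only on the underlying sets, so repeated literals are harmless.  The variable set of a formula
  consists of the variables occurring in it.
\<close>

type_synonym literal = "nat \<times> bool"
type_synonym clause = "literal list"
type_synonym cnf = "clause list"

type_synonym assignment = "nat \<rightharpoonup> bool"

definition vars :: "cnf \<Rightarrow> nat set" where
  "vars \<phi> = (\<Union>C\<in>set \<phi>. fst ` set C)"

definition double_horn :: "cnf \<Rightarrow> bool" where
  "double_horn \<phi> \<longleftrightarrow>
     (\<forall>C\<in>set \<phi>. card {x. (x, True) \<in> set C} \<le> 1 \<and> card {x. (x, False) \<in> set C} \<le> 1)"

definition sat_assignments :: "cnf \<Rightarrow> assignment set" where
  "sat_assignments \<phi> =
     {\<alpha>. dom \<alpha> = vars \<phi> \<and> (\<forall>C\<in>set \<phi>. \<exists>(x, b)\<in>set C. \<alpha> x = Some b)}"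

definition disagreement :: "nat set \<Rightarrow> assignment \<Rightarrow> assignment \<Rightarrow> nat set" where
  "disagreement X \<alpha> \<beta> = {x \<in> X. \<alpha> x \<noteq> \<beta> x}"

definition diversity :: "nat set \<Rightarrow> assignment list \<Rightarrow> nat" where
  "diversity X \<alpha>s = (\<Sum>j<length \<alpha>s. \<Sum>i<j. card (disagreement X (\<alpha>s ! i) (\<alpha>s ! j)))"

definition max_diverse :: "cnf \<Rightarrow> nat \<Rightarrow> assignment list \<Rightarrow> bool" where
  "max_diverse \<phi> k \<alpha>s \<longleftrightarrow>
     length \<alpha>s = k \<and> set \<alpha>s \<subseteq> sat_assignments \<phi> \<and>
     (\<forall>\<beta>s. length \<beta>s = k \<longrightarrow> set \<beta>s \<subseteq> sat_assignments \<phi> \<longrightarrow>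
        diversity (vars \<phi>) \<beta>s \<le> diversity (vars \<phi>) \<alpha>s)"


section \<open>Deterministic multi-tape Turing machines\<close>

text \<open>
  The working states are \<open>0, \<dots>, num_states - 1\<close>, with start state \<open>0\<close>; the machine halts on
  entering state \<open>num_states\<close>.  Tape symbols are \<open>0, \<dots>, num_syms - 1\<close>, where \<open>0\<close> is the blank.
  The transition function maps a working state and the symbols under the heads to the next state
  and, for each tape, a symbol to write and a head movement in \<open>{-1, 0, 1}\<close>.  Only its values on
  the finitely many arguments constrained by \<open>turing_machine\<close> are ever used.
\<close>

record tm =
  num_tapes :: nat
  num_syms :: nat
  num_states :: nat
  delta :: "nat \<Rightarrow> nat list \<Rightarrow> nat \<times> (nat \<times> int) list"

definition turing_machine :: "tm \<Rightarrow> bool" where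
  "turing_machine M \<longleftrightarrow>
     num_tapes M \<ge> 1 \<and> num_syms M \<ge> 1 \<and>
     (\<forall>q < num_states M. \<forall>s. length s = num_tapes M \<and> set s \<subseteq> {..<num_syms M} \<longrightarrow>
        (case delta M q s of (q', acts) \<Rightarrow>
           q' \<le> num_states M \<and> length acts = num_tapes M \<and>
           set acts \<subseteq> {..<num_syms M} \<times> {-1, 0, 1}))"

text \<open>
  Two-way infinite tapes are indexed relative to the head, which always sits on cell \<open>0\<close>: moving
  the head by \<open>d\<close> shifts the contents instead.
\<close>

type_synonym tape = "int \<Rightarrow> nat"
type_synonym config = "nat \<times> tape list"

definition act :: "nat \<times> int \<Rightarrow> tape \<Rightarrow> tape" where
  "act = (\<lambda>(a, d) t i. (t(0 := a)) (i + d))"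

definition step :: "tm \<Rightarrow> config \<Rightarrow> config" where
  "step M = (\<lambda>(q, ts).
     if q < num_states M
     then (case delta M q (map (\<lambda>t. t 0) ts) of (q', acts) \<Rightarrow> (q', map2 act acts ts))
     else (q, ts))"

definition tape_of :: "nat list \<Rightarrow> tape" where
  "tape_of w = (\<lambda>i. if 0 \<le> i \<and> i < int (length w) then w ! nat i else 0)"

definition init_config :: "tm \<Rightarrow> nat list \<Rightarrow> config" where
  "init_config M w = (0, tape_of w # replicate (num_tapes M - 1) (tape_of []))"

text \<open>
  The output is the nonblank word on the first tape that starts at the head and extends to the
  next blank.
\<close>

definition output_word :: "tape \<Rightarrow> nat list \<Rightarrow> bool" where
  "output_word t v \<longleftrightarrow>
     0 \<notin> set v \<and> (\<forall>i < length v. t (int i) = v ! i) \<and> t (int (length v)) = 0"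

text \<open>On input \<open>w\<close>, the machine \<open>M\<close> halts after at most \<open>n\<close> steps with output \<open>v\<close>.\<close>

definition computes_within :: "tm \<Rightarrow> nat list \<Rightarrow> nat \<Rightarrow> nat list \<Rightarrow> bool" where
  "computes_within M w n v \<longleftrightarrow>
     set w \<subseteq> {1..<num_syms M} \<and>
     (case (step M ^^ n) (init_config M w) of (q, ts) \<Rightarrow>
        q = num_states M \<and> output_word (hd ts) v)"


section \<open>Encoding of instances and solutions\<close>

text \<open>
  Symbols: \<open>1\<close>, \<open>2\<close> are the binary digits zero and one; \<open>3\<close>, \<open>4\<close> start a positive and a negative
  literal; \<open>5\<close> ends a list of literals; \<open>6\<close> is the tally mark for \<open>k\<close>; \<open>7\<close> reports
  unsatisfiability.  Variable names are written in binary, least significant digit first.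
\<close>

fun enc_nat :: "nat \<Rightarrow> nat list" where
  "enc_nat n = (if n = 0 then [] else (if even n then 1 else 2) # enc_nat (n div 2))"

declare enc_nat.simps [simp del]

definition enc_literal :: "literal \<Rightarrow> nat list" where
  "enc_literal = (\<lambda>(x, b). (if b then 3 else 4) # enc_nat x)"

definition enc_literals :: "literal list \<Rightarrow> nat list" where
  "enc_literals ls = concat (map enc_literal ls) @ [5]"

definition enc_cnf :: "cnf \<Rightarrow> nat list" where
  "enc_cnf \<phi> = concat (map enc_literals \<phi>)"

text \<open>
  The number \<open>k\<close> is written in unary, so that ``polynomial in the input length'' means polynomial
  in the size of \<open>\<phi>\<close> and \<open>k\<close>; the output itself lists \<open>k\<close> assignments explicitly.
\<close>

definition enc_instance :: "cnf \<Rightarrow> nat \<Rightarrow> nat list" where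
  "enc_instance \<phi> k = enc_cnf \<phi> @ replicate k 6"

text \<open>
  An assignment is written as the list of literals it makes true, in any order and with exactly
  one literal per variable, so a tuple of assignments is written like a formula.
\<close>

definition enc_assignments :: "nat list \<Rightarrow> assignment list \<Rightarrow> bool" where
  "enc_assignments v \<alpha>s \<longleftrightarrow>
     (\<exists>lss. v = enc_cnf lss \<and> (\<forall>ls\<in>set lss. distinct (map fst ls)) \<and> \<alpha>s = map map_of lss)"

definition unsat_report :: "nat list" where
  "unsat_report = [7]"

definition correct_output :: "cnf \<Rightarrow> nat \<Rightarrow> nat list \<Rightarrow> bool" where
  "correct_output \<phi> k v \<longleftrightarrow>
     (if sat_assignments \<phi> = {} then v = unsat_report
      else (\<exists>\<alpha>s. enc_assignments v \<alpha>s \<and> max_diverse \<phi> k \<alpha>s))"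

text \<open>The encoding is unambiguous.\<close>

lemma set_enc_nat: "set (enc_nat n) \<subseteq> {1, 2}"
  by (induction n rule: enc_nat.induct) (subst enc_nat.simps, auto)

lemma enc_nat_inject: "enc_nat m = enc_nat n \<longleftrightarrow> m = n"
proof
  show "enc_nat m = enc_nat n \<Longrightarrow> m = n"
  proof (induction m arbitrary: n rule: enc_nat.induct)
    case (1 m)
    show ?case
    proof (cases "m = 0 \<or> n = 0")
      case True
      with "1.prems" show ?thesis
        by (auto simp: enc_nat.simps[of m] enc_nat.simps[of n] split: if_splits)
    next
      case False
      with "1.prems" have "even m = even n" "enc_nat (m div 2) = enc_nat (n div 2)"
        by (auto simp: enc_nat.simps[of m] enc_nat.simps[of n] split: if_splits)
      with "1.IH" False have "m div 2 = n div 2" "even m = even n" by auto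
      then show ?thesis by presburger
    qed
  qed
qed simp

lemma append_separated_inject:
  assumes "set u \<subseteq> A" "set u' \<subseteq> A" "a \<notin> A" "a' \<notin> A" "u @ a # v = u' @ a' # v'"
  shows "u = u' \<and> a = a' \<and> v = v'"
  using assms
proof (induction u arbitrary: u')
  case Nil
  then show ?case by (cases u') auto
next
  case (Cons b u)
  then show ?case by (cases u') auto
qed

lemma enc_literals_append_inject:
  "enc_literals ls @ r = enc_literals ls' @ r' \<Longrightarrow> ls = ls' \<and> r = r'"
proof (induction ls arbitrary: ls')
  case Nil
  then show ?case
    by (cases ls') (auto simp: enc_literals_def enc_literal_def split: if_splits)
next
  case (Cons l ls)
  obtain x b where l: "l = (x, b)" by force
  from Cons.prems obtain l' ms where ls': "ls' = l' # ms"
    by (cases ls') (auto simp: enc_literals_def enc_literal_def l split: if_splits)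
  obtain x' b' where l': "l' = (x', b')" by force
  have hd: "\<exists>a u. enc_literals ns @ s = a # u \<and> a \<notin> {1, 2}" for ns s
    by (cases ns) (auto simp: enc_literals_def enc_literal_def split: prod.splits)
  from hd[of ls r] hd[of ms r'] obtain a u a' u' where
    u: "enc_literals ls @ r = a # u" "a \<notin> {1, 2}" and
    u': "enc_literals ms @ r' = a' # u'" "a' \<notin> {1, 2}" by metis
  from Cons.prems have "b = b'"
    and "enc_nat x @ enc_literals ls @ r = enc_nat x' @ enc_literals ms @ r'"
    by (auto simp: enc_literals_def enc_literal_def l l' ls' split: if_splits)
  with append_separated_inject[OF set_enc_nat set_enc_nat u(2) u'(2)] u(1) u'(1)
  have "x = x'" "enc_literals ls @ r = enc_literals ms @ r'"
    by (metis enc_nat_inject)+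
  with Cons.IH \<open>b = b'\<close> show ?case by (simp add: l l' ls')
qed

lemma enc_instance_inject: "enc_instance \<phi> k = enc_instance \<psi> l \<Longrightarrow> \<phi> = \<psi> \<and> k = l"
proof (induction \<phi> arbitrary: \<psi>)
  case Nil
  have "6 \<notin> set (enc_nat x)" for x using set_enc_nat[of x] by auto
  show ?case
  proof (cases \<psi>)
    case Nil
    with \<open>enc_instance [] k = enc_instance \<psi> l\<close> show ?thesis
      by (auto simp: enc_instance_def enc_cnf_def dest: arg_cong[of _ _ length])
  next
    case (Cons C \<psi>')
    with \<open>enc_instance [] k = enc_instance \<psi> l\<close> have "5 \<in> set (replicate k 6 :: nat list)"
      by (simp add: enc_instance_def enc_cnf_def enc_literals_def)
    then show ?thesis by simp
  qed
next
  case (Cons C \<phi>)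
  show ?case
  proof (cases \<psi>)
    case Nil
    have "5 \<in> set (enc_instance (C # \<phi>) k)"
      by (simp add: enc_instance_def enc_cnf_def enc_literals_def)
    with Cons.prems Nil show ?thesis by (simp add: enc_instance_def enc_cnf_def)
  next
    case (Cons D \<psi>')
    with Cons.prems have "enc_literals C @ enc_instance \<phi> k = enc_literals D @ enc_instance \<psi>' l"
      by (simp add: enc_instance_def enc_cnf_def)
    with enc_literals_append_inject Cons.IH \<open>\<psi> = D # \<psi>'\<close> show ?thesis by blast
  qed
qed

lemma enc_cnf_inject: "enc_cnf \<phi> = enc_cnf \<psi> \<longleftrightarrow> \<phi> = \<psi>"
  using enc_instance_inject[of \<phi> 0 \<psi> 0] by (auto simp: enc_instance_def)

end

(*
  Call a variable forced if unit propagation fixes its value.  Setting all other variables to false,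
  or all of them to true, gives a satisfying assignment unless propagation runs into a conflict: a
  clause not satisfied by the forced values has unforced literals of both signs.  A forced
  variable contributes nothing to the diversity of any k satisfying assignments, and any other variable at most
  floor(k/2) * ceiling(k/2), so alternating between the two assignments is optimal.

  Every tape of the machine holds a stack with its top under the head, so that a pop blanks the cell
  and moves right.  Each loop of the stack program shrinks a stack, so a polynomial bound on the
  stacks at the loops yields a polynomial time bound.
*)

theory Submission
  imports Defs
begin

section \<open>Stack programs\<close>

text \<open>For each sign \<open>b\<close>, a clause is read as an implication: if all its literals
  of sign \<open>\<not> b\<close> are false, then one of sign \<open>b\<close> holds. With at most
  one variable of sign \<open>b\<close> the conclusion is definite and can be recorded as forced.
  The propagations for the two signs do not interact, since facts of one sign only lead to facts of
  the same sign. For a satisfiable formula their closures describe the least and the greatest model,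
  and these are the two assignments that alternate. Until the facts of a sign are closed, every
  round without a conflict adds a variable to them. There are fewer variables than input symbols
  because \<open>k \<ge> 1\<close>, so a second copy of the input serves as round counter and
  replaces a fixpoint test. Facts are recorded again whenever a clause fires, so the dictionary may
  grow to quadratic size; this dictates the bound on the stacks.\<close>

datatype com =
    Skip
  | Push nat nat
  | Copy nat nat
  | Pop nat
  | Seq com com  (infixr \<open>;;\<close> 60)
  | Cond "nat list \<Rightarrow> bool" com com
  | Loop nat "nat list \<Rightarrow> bool" com

type_synonym stacks = "nat list list"

text \<open>An empty stack shows 0, the blank, just like the head of the tape that holds it. Guards
  therefore test emptiness by comparison with 0.\<close>

definition peek :: "nat list \<Rightarrow> nat" where
  "peek w = (case w of [] \<Rightarrow> 0 | a # _ \<Rightarrow> a)"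

lemma peek_simps [simp]: "peek [] = 0" "peek (a # w) = a"
  by (simp_all add: peek_def)

text \<open>
  The stack named in a loop must shrink in every iteration and have at most \<open>B\<close> entries, so that
  the running time is polynomial in \<open>B\<close>.
\<close>

inductive ev :: "nat \<Rightarrow> com \<Rightarrow> stacks \<Rightarrow> stacks \<Rightarrow> bool" for B where
  Skip: "ev B Skip s s"
| Push: "ev B (Push i a) s (s[i := a # s ! i])"
| Copy: "ev B (Copy i j) s (s[j := peek (s ! i) # s ! j])"
| Pop: "ev B (Pop i) s (s[i := tl (s ! i)])"
| Seq: "ev B c s s' \<Longrightarrow> ev B d s' s'' \<Longrightarrow> ev B (c ;; d) s s''"
| CondT: "P (map peek s) \<Longrightarrow> ev B c s s' \<Longrightarrow> ev B (Cond P c d) s s'"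
| CondF: "\<not> P (map peek s) \<Longrightarrow> ev B d s s' \<Longrightarrow> ev B (Cond P c d) s s'"
| LoopF: "\<not> P (map peek s) \<Longrightarrow> ev B (Loop i P c) s s"
| LoopT: "P (map peek s) \<Longrightarrow> length (s ! i) \<le> B \<Longrightarrow> ev B c s s' \<Longrightarrow>
    length (s' ! i) < length (s ! i) \<Longrightarrow> ev B (Loop i P c) s' s'' \<Longrightarrow> ev B (Loop i P c) s s''"

lemma length_ev: "ev B c s s' \<Longrightarrow> length s' = length s"
  by (induction rule: ev.induct) auto

text \<open>Existence of an evaluation includes termination and the bound \<open>B\<close> at each
  loop iteration, which is all that the time bound needs. Used as rewrite rules, the equations below
  execute loop-free code symbolically.\<close>

definition wp :: "nat \<Rightarrow> com \<Rightarrow> (stacks \<Rightarrow> bool) \<Rightarrow> stacks \<Rightarrow> bool" where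
  "wp B c Q s \<longleftrightarrow> (\<exists>s'. ev B c s s' \<and> Q s')"

inductive_cases ev_SkipE: "ev B Skip s s'"
inductive_cases ev_PushE: "ev B (Push i a) s s'"
inductive_cases ev_CopyE: "ev B (Copy i j) s s'"
inductive_cases ev_PopE: "ev B (Pop i) s s'"
inductive_cases ev_SeqE: "ev B (c ;; d) s s'"
inductive_cases ev_CondE: "ev B (Cond P c d) s s'"

lemma wp_simps [simp]:
  "wp B Skip Q s \<longleftrightarrow> Q s"
  "wp B (Push i a) Q s \<longleftrightarrow> Q (s[i := a # s ! i])"
  "wp B (Copy i j) Q s \<longleftrightarrow> Q (s[j := peek (s ! i) # s ! j])"
  "wp B (Pop i) Q s \<longleftrightarrow> Q (s[i := tl (s ! i)])"
  "wp B (c ;; d) Q s \<longleftrightarrow> wp B c (wp B d Q) s"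
  "wp B (Cond P c d) Q s \<longleftrightarrow> (if P (map peek s) then wp B c Q s else wp B d Q s)"
  unfolding wp_def
  by (blast intro: ev.intros elim: ev_SkipE ev_PushE ev_CopyE ev_PopE ev_SeqE)+
     (auto intro: ev.intros elim: ev_CondE)

lemma wp_Loop_done: "\<not> P (map peek s) \<Longrightarrow> Q s \<Longrightarrow> wp B (Loop i P c) Q s"
  unfolding wp_def by (blast intro: ev.LoopF)

text \<open>Loops are verified by unrolling one iteration inside an induction on the data they
  consume, instead of by an invariant.\<close>

lemma wp_Loop_step:
  "P (map peek s) \<Longrightarrow> length (s ! i) \<le> B \<Longrightarrow>
   wp B c (\<lambda>s'. length (s' ! i) < length (s ! i) \<and> wp B (Loop i P c) Q s') s \<Longrightarrow>
   wp B (Loop i P c) Q s"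
  unfolding wp_def by (blast intro: ev.LoopT)


section \<open>Compilation to Turing machines\<close>

type_synonym instr = "nat list \<Rightarrow> nat \<times> (nat \<times> int) list"

definition stay :: "nat list \<Rightarrow> (nat \<times> int) list" where
  "stay h = map (\<lambda>a. (a, 0)) h"

fun csize :: "com \<Rightarrow> nat" where
  "csize Skip = 0"
| "csize (Push i a) = 2"
| "csize (Copy i j) = 2"
| "csize (Pop i) = 1"
| "csize (c ;; d) = csize c + csize d"
| "csize (Cond P c d) = csize c + csize d + 2"
| "csize (Loop i P c) = csize c + 2"

text \<open>States are absolute addresses: a block starts at \<open>l\<close> and leaves through
  \<open>l + csize c\<close>, which for the whole program is the halting state. An action writes
  before it moves, so a push takes two steps: rewrite the old top and move left, then write the new
  top. In \<open>Copy i j\<close> head \<open>i\<close> rests during the first step, so the second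
  still reads the symbol to be copied; hence \<open>i \<noteq> j\<close> in
  \<open>wf_com\<close>.\<close>

fun compile :: "com \<Rightarrow> nat \<Rightarrow> instr list" where
  "compile Skip l = []"
| "compile (Push i a) l =
     [\<lambda>h. (l + 1, (stay h)[i := (h ! i, -1)]), \<lambda>h. (l + 2, (stay h)[i := (a, 0)])]"
| "compile (Copy i j) l =
     [\<lambda>h. (l + 1, (stay h)[j := (h ! j, -1)]), \<lambda>h. (l + 2, (stay h)[j := (h ! i, 0)])]"
| "compile (Pop i) l = [\<lambda>h. (l + 1, (stay h)[i := (0, 1)])]"
| "compile (c ;; d) l = compile c l @ compile d (l + csize c)"
| "compile (Cond P c d) l =
     (\<lambda>h. (if P h then l + 1 else l + csize c + 2, stay h)) # compile c (l + 1) @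
     (\<lambda>h. (l + csize c + csize d + 2, stay h)) # compile d (l + csize c + 2)"
| "compile (Loop i P c) l =
     (\<lambda>h. (if P h then l + 1 else l + csize c + 2, stay h)) # compile c (l + 1) @
     [\<lambda>h. (l, stay h)]"

fun wf_com :: "nat \<Rightarrow> nat \<Rightarrow> com \<Rightarrow> bool" where
  "wf_com K S Skip \<longleftrightarrow> True"
| "wf_com K S (Push i a) \<longleftrightarrow> i < K \<and> a < S"
| "wf_com K S (Copy i j) \<longleftrightarrow> i < K \<and> j < K \<and> i \<noteq> j"
| "wf_com K S (Pop i) \<longleftrightarrow> i < K"
| "wf_com K S (c ;; d) \<longleftrightarrow> wf_com K S c \<and> wf_com K S d"
| "wf_com K S (Cond P c d) \<longleftrightarrow> wf_com K S c \<and> wf_com K S d"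
| "wf_com K S (Loop i P c) \<longleftrightarrow> wf_com K S c"

text \<open>The indeterminate stands for \<open>B\<close>. Each of at most \<open>B\<close>
  iterations pays for a test and a jump back besides the body; the last 1 is the failing
  test.\<close>

fun time :: "com \<Rightarrow> nat poly" where
  "time Skip = 0"
| "time (Push i a) = [:2:]"
| "time (Copy i j) = [:2:]"
| "time (Pop i) = [:1:]"
| "time (c ;; d) = time c + time d"
| "time (Cond P c d) = time c + time d + [:2:]"
| "time (Loop i P c) = [:0, 1:] * (time c + [:2:]) + [:1:]"

definition machine :: "nat \<Rightarrow> nat \<Rightarrow> com \<Rightarrow> tm" where
  "machine K S c = \<lparr>num_tapes = K, num_syms = S, num_states = csize c, delta = (\<lambda>q. compile c 0 ! q)\<rparr>"

lemma length_compile [simp]: "length (compile c l) = csize c"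
  by (induction c arbitrary: l) auto

lemma length_stay [simp]: "length (stay h) = length h"
  by (simp add: stay_def)

lemma stay_nth [simp]: "i < length h \<Longrightarrow> stay h ! i = (h ! i, 0)"
  by (simp add: stay_def)

definition good_instr :: "nat \<Rightarrow> nat \<Rightarrow> nat \<Rightarrow> instr \<Rightarrow> bool" where
  "good_instr K S n f \<longleftrightarrow> (\<forall>h. length h = K \<and> set h \<subseteq> {..<S} \<longrightarrow>
     (case f h of (q', acts) \<Rightarrow> q' \<le> n \<and> length acts = K \<and> set acts \<subseteq> {..<S} \<times> {-1, 0, 1}))"

lemma set_stay: "set h \<subseteq> {..<S} \<Longrightarrow> set (stay h) \<subseteq> {..<S} \<times> {-1, 0, 1}"
  by (auto simp: stay_def)

lemma set_stay_update:
  "set h \<subseteq> {..<S} \<Longrightarrow> a < S \<Longrightarrow> d \<in> {-1, 0, 1} \<Longrightarrow>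
   set ((stay h)[i := (a, d)]) \<subseteq> {..<S} \<times> {-1, 0, 1}"
  using set_update_subset_insert[of "stay h" i "(a, d)"] set_stay[of h S] by auto

lemma good_instr_stay: "(\<And>h. q h \<le> n) \<Longrightarrow> good_instr K S n (\<lambda>h. (q h, stay h))"
  using set_stay by (auto simp: good_instr_def)

lemma good_instr_write:
  assumes "\<And>h. length h = K \<Longrightarrow> set h \<subseteq> {..<S} \<Longrightarrow> a h < S" "d \<in> {-1, 0, 1}" "q \<le> n"
  shows "good_instr K S n (\<lambda>h. (q, (stay h)[i := (a h, d)]))"
  using set_stay_update[OF _ assms(1,2)] assms(3) unfolding good_instr_def by simp

lemma good_instr_compile:
  assumes "wf_com K S c" "l + csize c \<le> n" "0 < S" "f \<in> set (compile c l)"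
  shows "good_instr K S n f"
proof -
  have nth: "h ! i < S" if "i < K" "length h = K" "set h \<subseteq> {..<S}" for h i
    using that nth_mem by fastforce
  show ?thesis
    using assms
  proof (induction c arbitrary: l)
    case (Cond P c d)
    from Cond.prems Cond.IH(1)[of "l + 1"] Cond.IH(2)[of "l + csize c + 2"]
    show ?case by (auto intro!: good_instr_stay)
  next
    case (Loop i P c)
    from Loop.prems Loop.IH[of "l + 1"] show ?case by (auto intro!: good_instr_stay)
  next
    case (Seq c d)
    from Seq.prems Seq.IH(1)[of l] Seq.IH(2)[of "l + csize c"] show ?case by auto
  qed (auto intro!: good_instr_write nth)
qed

lemma turing_machine_machine:
  assumes "wf_com K S c" "0 < K" "0 < S"
  shows "turing_machine (machine K S c)"
proof -
  have "good_instr K S (csize c) (compile c 0 ! q)" if "q < csize c" for q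
    using good_instr_compile[OF assms(1), of 0 "csize c" "compile c 0 ! q"] that assms(3) by simp
  with assms show ?thesis by (simp add: turing_machine_def machine_def good_instr_def)
qed

section \<open>Stack operations as actions on tapes\<close>

lemma tape_of_peek [simp]: "tape_of w 0 = peek w"
  by (cases w) (auto simp: tape_of_def)

lemma act_stay [simp]: "act (t 0, 0) t = t"
  by (auto simp: act_def)

lemma act_pop: "act (0, 1) (tape_of w) = tape_of (tl w)"
proof
  fix i show "act (0, 1) (tape_of w) i = tape_of (tl w) i"
    by (cases w) (auto simp: act_def tape_of_def nth_Cons' nat_add_distrib)
qed

lemma act_push: "act (a, 0) (act (peek w, -1) (tape_of w)) = tape_of (a # w)"
proof
  fix i show "act (a, 0) (act (peek w, -1) (tape_of w)) i = tape_of (a # w) i"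
    by (cases w) (auto simp: act_def tape_of_def nth_Cons' nat_diff_distrib)
qed

lemma map2_act_stay [simp]:
  "map2 act (stay (map (\<lambda>t. t 0) ts)) ts = ts"
  by (rule nth_equalityI) auto

lemma map2_act_update:
  "i < length ts \<Longrightarrow>
   map2 act ((stay (map (\<lambda>t. t 0) ts))[i := x]) ts = ts[i := act x (ts ! i)]"
  by (rule nth_equalityI) (auto simp: nth_list_update)

text \<open>Since addresses are absolute, a block cannot be simulated in isolation: the code of the
  whole program is kept, together with the position of the block in it.\<close>

definition placed :: "instr list \<Rightarrow> nat \<Rightarrow> instr list \<Rightarrow> bool" where
  "placed p l xs \<longleftrightarrow> (\<exists>us vs. p = us @ xs @ vs \<and> length us = l)"

lemma placed_append: "placed p l (xs @ ys) \<longleftrightarrow> placed p l xs \<and> placed p (l + length xs) ys"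
proof
  assume "placed p l (xs @ ys)"
  then obtain us vs where "p = us @ (xs @ ys) @ vs" "length us = l" unfolding placed_def by blast
  then have "p = us @ xs @ (ys @ vs)" "p = (us @ xs) @ ys @ vs" by simp_all
  with \<open>length us = l\<close> show "placed p l xs \<and> placed p (l + length xs) ys" unfolding placed_def
    by (metis length_append)
next
  assume "placed p l xs \<and> placed p (l + length xs) ys"
  then obtain us vs us' vs' where p: "p = us @ xs @ vs" "length us = l"
    "p = us' @ ys @ vs'" "length us' = l + length xs" unfolding placed_def by blast
  then have "(us @ xs) @ vs = us' @ ys @ vs'" "length (us @ xs) = length us'" by simp_all
  then have "us' = us @ xs" "vs = ys @ vs'" by (metis append_eq_append_conv)+
  with p show "placed p l (xs @ ys)" unfolding placed_def by auto
qed

lemma placed_Cons: "placed p l (x # xs) \<longleftrightarrow> placed p l [x] \<and> placed p (Suc l) xs"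
  using placed_append[of p l "[x]" xs] by simp

lemma step_machine:
  assumes "placed (compile c 0) l [f]"
  shows "step (machine K S c) (l, ts) =
    (case f (map (\<lambda>t. t 0) ts) of (q', acts) \<Rightarrow> (q', map2 act acts ts))"
proof -
  obtain us vs where "compile c 0 = us @ [f] @ vs" "length us = l" using assms unfolding placed_def by blast
  moreover from this have "csize c = length (us @ [f] @ vs)" by (metis length_compile)
  ultimately show ?thesis by (auto simp: step_def machine_def nth_append)
qed

lemma step_machine_write:
  assumes "placed (compile c 0) l [\<lambda>h. (q, (stay h)[i := (a h, d)])]" "i < length ts"
  shows "step (machine K S c) (l, ts) = (q, ts[i := act (a (map (\<lambda>t. t 0) ts), d) (ts ! i)])"
  by (simp add: step_machine[OF assms(1)] map2_act_update[OF assms(2)])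

section \<open>Simulation of stack programs with a step count\<close>

definition reach :: "tm \<Rightarrow> config \<Rightarrow> nat \<Rightarrow> config \<Rightarrow> bool" where
  "reach M x n y \<longleftrightarrow> (\<exists>m \<le> n. (step M ^^ m) x = y)"

lemma reach_refl: "reach M x n x"
  unfolding reach_def by (rule exI[of _ 0]) auto

lemma reach_trans: "reach M x m y \<Longrightarrow> reach M y n z \<Longrightarrow> reach M x (m + n) z"
  unfolding reach_def
proof clarify
  fix a b assume "a \<le> m" "b \<le> n"
  then show "\<exists>k\<le>m + n. (step M ^^ k) x = (step M ^^ b) ((step M ^^ a) x)"
    by (intro exI[of _ "b + a"]) (auto simp: funpow_add)
qed

lemma reach_step: "step M x = y \<Longrightarrow> reach M x (Suc 0) y"
  unfolding reach_def by (rule exI[of _ "Suc 0"]) auto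

lemma reach_mono: "reach M x m y \<Longrightarrow> m \<le> n \<Longrightarrow> reach M x n y"
  unfolding reach_def using le_trans by blast

text \<open>The polynomial \<open>time\<close> charges a loop for \<open>B\<close> iterations and
  does not decrease while the loop runs. Charging by the current height of the stack gives a
  quantity that decreases, as the induction over evaluations requires; \<open>min\<close> keeps it
  below \<open>time\<close> for stacks of any height.\<close>

definition steps :: "nat \<Rightarrow> com \<Rightarrow> stacks \<Rightarrow> nat" where
  "steps B c s = (case c of Loop i P d \<Rightarrow> min (length (s ! i)) B * (poly (time d) B + 2) + 1
     | _ \<Rightarrow> poly (time c) B)"

lemma steps_le: "steps B c s \<le> poly (time c) B"
  by (cases c) (auto simp: steps_def algebra_simps intro!: add_mono mult_right_mono)

lemma ev_reach:
  assumes "ev B c s s'" "wf_com K S c" "placed (compile c0 0) l (compile c l)" "length s = K"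
  shows "reach (machine K S c0) (l, map tape_of s) (steps B c s) (l + csize c, map tape_of s')"
  using assms
proof (induction arbitrary: l rule: ev.induct)
  case (Skip s)
  then show ?case by (simp add: reach_refl)
next
  case (Push i a s)
  let ?M = "machine K S c0"
  from Push have 1: "placed (compile c0 0) l [\<lambda>h. (l + 1, (stay h)[i := (h ! i, -1)])]"
    and 2: "placed (compile c0 0) (Suc l) [\<lambda>h. (l + 2, (stay h)[i := (a, 0)])]"
    and i: "i < length s"
    by (simp_all add: placed_Cons[of _ _ _ "[_]"])
  have "step ?M (step ?M (l, map tape_of s)) = (l + 2, map tape_of (s[i := a # s ! i]))"
    using i by (simp add: step_machine_write[OF 1] step_machine_write[OF 2] act_push map_update)
  then show ?case using reach_trans[OF reach_step[OF refl] reach_step[OF refl]]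
    by (simp add: steps_def numeral_2_eq_2) metis
next
  case (Copy i j s)
  let ?M = "machine K S c0"
  from Copy have 1: "placed (compile c0 0) l [\<lambda>h. (l + 1, (stay h)[j := (h ! j, -1)])]"
    and 2: "placed (compile c0 0) (Suc l) [\<lambda>h. (l + 2, (stay h)[j := (h ! i, 0)])]"
    and i: "i < length s" "j < length s" "i \<noteq> j"
    by (simp_all add: placed_Cons[of _ _ _ "[_]"])
  have "step ?M (step ?M (l, map tape_of s)) = (l + 2, map tape_of (s[j := peek (s ! i) # s ! j]))"
    using i by (simp add: step_machine_write[OF 1] step_machine_write[OF 2] act_push map_update)
  then show ?case using reach_trans[OF reach_step[OF refl] reach_step[OF refl]]
    by (simp add: steps_def numeral_2_eq_2) metis
next
  case (Pop i s)
  then have 1: "placed (compile c0 0) l [\<lambda>h. (l + 1, (stay h)[i := (0, 1)])]" and i: "i < length s"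
    by simp_all
  have "step (machine K S c0) (l, map tape_of s) = (l + 1, map tape_of (s[i := tl (s ! i)]))"
    using i by (simp add: step_machine_write[OF 1] act_pop map_update)
  from reach_step[OF this] show ?case by (simp add: steps_def)
next
  case (Seq c s s' d s'')
  let ?M = "machine K S c0"
  have "length s' = K" using length_ev[OF Seq.hyps(1)] Seq.prems by simp
  with Seq have "reach ?M (l, map tape_of s) (steps B c s) (l + csize c, map tape_of s')"
    "reach ?M (l + csize c, map tape_of s') (steps B d s') (l + csize c + csize d, map tape_of s'')"
    by (auto simp: placed_append)
  from reach_trans[OF this]
  have "reach ?M (l, map tape_of s) (steps B c s + steps B d s') (l + csize (c ;; d), map tape_of s'')"
    by (simp add: add.assoc)
  moreover have "steps B c s + steps B d s' \<le> steps B (c ;; d) s"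
    by (simp add: steps_def[of _ "_ ;; _"] add_mono steps_le)
  ultimately show ?case by (rule reach_mono)
next
  case (CondT P s c s' d)
  let ?M = "machine K S c0"
  from CondT.prems
  have 1: "placed (compile c0 0) l
      [\<lambda>h. (if P h then l + 1 else l + csize c + 2, stay h)]"
    and 2: "placed (compile c0 0) (l + 1) (compile c (l + 1))"
    and 3: "placed (compile c0 0) (l + 1 + csize c) [\<lambda>h. (l + csize c + csize d + 2, stay h)]"
    by (simp_all add: placed_Cons[of _ _ _ "_ @ _"] placed_append placed_Cons[of _ _ _ "compile d _"])
  have "reach ?M (l, map tape_of s) 1 (l + 1, map tape_of s)"
    using step_machine[OF 1] CondT.hyps by (simp add: o_def reach_step)
  moreover have "reach ?M (l + 1, map tape_of s) (steps B c s) (l + 1 + csize c, map tape_of s')"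
    using CondT.IH[OF _ 2] CondT.prems by simp
  moreover have "reach ?M (l + 1 + csize c, map tape_of s') 1
      (l + csize c + csize d + 2, map tape_of s')"
    using step_machine[OF 3] by (simp add: reach_step)
  ultimately have "reach ?M (l, map tape_of s) (1 + steps B c s + 1)
      (l + csize c + csize d + 2, map tape_of s')"
    by (blast intro: reach_trans)
  moreover have "1 + steps B c s + 1 \<le> steps B (Cond P c d) s"
    using steps_le[of B c s] by (simp add: steps_def[of _ "Cond _ _ _"])
  ultimately show ?case by (simp add: reach_mono add.assoc)
next
  case (CondF P s d s' c)
  let ?M = "machine K S c0"
  from CondF.prems
  have 1: "placed (compile c0 0) l
      [\<lambda>h. (if P h then l + 1 else l + csize c + 2, stay h)]"
    and 2: "placed (compile c0 0) (l + csize c + 2) (compile d (l + csize c + 2))"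
    by (simp_all add: placed_Cons[of _ _ _ "_ @ _"] placed_append placed_Cons[of _ _ _ "compile d _"])
  have "reach ?M (l, map tape_of s) 1 (l + csize c + 2, map tape_of s)"
    using step_machine[OF 1] CondF.hyps by (simp add: o_def reach_step)
  moreover have "reach ?M (l + csize c + 2, map tape_of s) (steps B d s)
      (l + csize c + 2 + csize d, map tape_of s')"
    using CondF.IH[OF _ 2] CondF.prems by simp
  ultimately have "reach ?M (l, map tape_of s) (1 + steps B d s)
      (l + csize c + 2 + csize d, map tape_of s')"
    by (rule reach_trans)
  moreover have "1 + steps B d s \<le> steps B (Cond P c d) s"
    using steps_le[of B d s] by (simp add: steps_def[of _ "Cond _ _ _"])
  ultimately show ?case by (simp add: reach_mono add_ac)
next
  case (LoopF P s i c)
  from LoopF.prems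
  have 1: "placed (compile c0 0) l
      [\<lambda>h. (if P h then l + 1 else l + csize c + 2, stay h)]"
    by (simp add: placed_Cons[of _ _ _ "_ @ _"])
  have "reach (machine K S c0) (l, map tape_of s) 1 (l + csize c + 2, map tape_of s)"
    using step_machine[OF 1] LoopF.hyps by (simp add: o_def reach_step)
  moreover have "1 \<le> steps B (Loop i P c) s"
    by (simp add: steps_def)
  ultimately show ?case by (simp add: reach_mono add.assoc)
next
  case (LoopT P s i c s' s'')
  let ?M = "machine K S c0"
  have len: "length s' = K" using length_ev[OF LoopT.hyps(3)] LoopT.prems by simp
  from LoopT.prems
  have 1: "placed (compile c0 0) l
      [\<lambda>h. (if P h then l + 1 else l + csize c + 2, stay h)]"
    and 2: "placed (compile c0 0) (l + 1) (compile c (l + 1))"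
    and 3: "placed (compile c0 0) (l + 1 + csize c) [\<lambda>h. (l, stay h)]"
    by (simp_all add: placed_Cons[of _ _ _ "_ @ _"] placed_append)
  have "reach ?M (l, map tape_of s) 1 (l + 1, map tape_of s)"
    using step_machine[OF 1] LoopT.hyps by (simp add: o_def reach_step)
  moreover have "reach ?M (l + 1, map tape_of s) (steps B c s) (l + 1 + csize c, map tape_of s')"
    using LoopT.IH(1)[OF _ 2] LoopT.prems by simp
  moreover have "reach ?M (l + 1 + csize c, map tape_of s') 1 (l, map tape_of s')"
    using step_machine[OF 3] by (simp add: reach_step)
  moreover have "reach ?M (l, map tape_of s') (steps B (Loop i P c) s')
      (l + csize (Loop i P c), map tape_of s'')"
    using LoopT.prems len by (intro LoopT.IH)
  ultimately have *: "reach ?M (l, map tape_of s)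
      (1 + steps B c s + 1 + steps B (Loop i P c) s') (l + csize (Loop i P c), map tape_of s'')"
    by (meson reach_trans)
  \<comment> \<open>Stack \<open>i\<close> has shrunk, so at least one iteration fewer remains to be
    charged; the share set free pays for the body, the test and the jump back.\<close>
  have "steps B (Loop i P c) s' \<le> (length (s ! i) - 1) * (poly (time c) B + 2) + 1"
    unfolding steps_def using LoopT.hyps by (auto simp del: mult_Suc mult_Suc_right intro!: mult_right_mono)
  moreover have "length (s ! i) * (poly (time c) B + 2)
    = (length (s ! i) - 1) * (poly (time c) B + 2) + (poly (time c) B + 2)"
    using LoopT.hyps by (cases "length (s ! i)") auto
  ultimately have "1 + steps B c s + 1 + steps B (Loop i P c) s' \<le> steps B (Loop i P c) s"
    using steps_le[of B c s] LoopT.hyps by (simp add: steps_def[of B "Loop i P c" s])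
  with * show ?case by (rule reach_mono)
qed

lemma funpow_halted: "(step M ^^ n) (num_states M, ts) = (num_states M, ts)"
  by (induction n) (auto simp: step_def)

lemma computes_within_machine:
  assumes "wp B c (\<lambda>s. hd s = v) (w # replicate (K - 1) [])" "wf_com K S c" "0 < K"
    and "set w \<subseteq> {1..<S}" "0 \<notin> set v" "poly (time c) B \<le> n"
  shows "computes_within (machine K S c) w n v"
proof -
  from assms(1) obtain s' where ev: "ev B c (w # replicate (K - 1) []) s'" and v: "hd s' = v"
    unfolding wp_def by blast
  have "length s' = K" using length_ev[OF ev] assms(3) by simp
  with v assms(3) obtain s'' where s': "s' = v # s''" by (cases s') auto
  let ?M = "machine K S c"
  have "placed (compile c 0) 0 (compile c 0)" unfolding placed_def by auto
  from ev_reach[OF ev assms(2) this] assms(3)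
  have "reach ?M (0, map tape_of (w # replicate (K - 1) []))
      (steps B c (w # replicate (K - 1) [])) (csize c, map tape_of s')" by simp
  from reach_mono[OF this le_trans[OF steps_le assms(6)]]
  obtain m where m: "m \<le> n" "(step ?M ^^ m) (init_config ?M w) = (csize c, map tape_of s')"
    unfolding reach_def by (auto simp: init_config_def machine_def)
  \<comment> \<open>\<open>computes_within\<close> inspects the configuration after exactly
    \<open>n\<close> steps; a halted machine idles, so halting earlier is harmless.\<close>
  have "(step ?M ^^ n) (init_config ?M w) = (step ?M ^^ (n - m)) ((step ?M ^^ m) (init_config ?M w))"
    using m(1) by (metis add.commute comp_apply funpow_add le_add_diff_inverse)
  also have "\<dots> = (num_states ?M, map tape_of s')"
    using m(2) funpow_halted[of "n - m" ?M] by (simp add: machine_def)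
  finally show ?thesis using assms(4,5)
    by (auto simp: computes_within_def output_word_def s' machine_def tape_of_def)
qed

section \<open>The program\<close>

lemma list_update_Cons_numeral [simp]:
  "(x # xs)[numeral v := y] = x # xs[pred_numeral v := y]"
  by (simp add: numeral_eq_Suc)

section \<open>Moving and dropping blocks, flags\<close>

definition mv :: "nat \<Rightarrow> nat \<Rightarrow> nat set \<Rightarrow> com" where
  "mv i j A = Loop i (\<lambda>h. h ! i \<in> A) (Copy i j ;; Pop i)"

definition drop_all :: "nat \<Rightarrow> nat set \<Rightarrow> com" where
  "drop_all i A = Loop i (\<lambda>h. h ! i \<in> A) (Pop i)"

text \<open>A moved word arrives reversed. So a scanned stack is restored by moving it back, and
  words whose order matters travel through a second stack.\<close>

lemma wp_mv:
  assumes "s ! i = w @ v" "set w \<subseteq> A" "peek v \<notin> A" "i \<noteq> j" "i < length s" "j < length s"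
    "length (w @ v) \<le> B" "Q (s[i := v, j := rev w @ s ! j])"
  shows "wp B (mv i j A) Q s"
  using assms
proof (induction w arbitrary: s)
  case Nil
  then have "s[i := v, j := s ! j] = s" by (metis append_Nil list_update_id)
  with Nil show ?case by (auto simp: mv_def intro!: wp_Loop_done)
next
  case (Cons a w)
  let ?s = "s[j := a # s ! j, i := w @ v]"
  have "wp B (mv i j A) Q ?s"
    using Cons.prems by (intro Cons.IH) (auto simp: list_update_swap[of j i])
  with Cons.prems show ?case unfolding mv_def
    by (intro wp_Loop_step) (auto simp: list_update_swap)
qed

lemma wp_drop_all:
  assumes "s ! i = w @ v" "set w \<subseteq> A" "peek v \<notin> A" "i < length s"
    "length (w @ v) \<le> B" "Q (s[i := v])"
  shows "wp B (drop_all i A) Q s"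
  using assms
proof (induction w arbitrary: s)
  case Nil
  then have "s[i := v] = s" by (metis append_Nil list_update_id)
  with Nil show ?case by (auto simp: drop_all_def intro!: wp_Loop_done)
next
  case (Cons a w)
  have "wp B (drop_all i A) Q (s[i := w @ v])"
    using Cons.prems by (intro Cons.IH) auto
  with Cons.prems show ?case unfolding drop_all_def
    by (intro wp_Loop_step) auto
qed

definition flag :: "bool \<Rightarrow> nat list" where
  "flag b = (if b then [1] else [])"

lemma flag_simps [simp]:
  "flag False = []" "flag True = [1]" "peek (flag b) = 0 \<longleftrightarrow> \<not> b" "0 < peek (flag b) \<longleftrightarrow> b" "tl (flag b) = []"
  by (simp_all add: flag_def)

text \<open>A flag stack never holds more than one symbol, so a single \<open>Pop\<close> clears it
  however often it was raised.\<close>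

definition set_flag :: "nat \<Rightarrow> com" where
  "set_flag i = Cond (\<lambda>h. h ! i = 0) (Push i 1) Skip"

lemma wp_set_flag [simp]:
  "i < length s \<Longrightarrow> s ! i = flag b \<Longrightarrow> wp B (set_flag i) Q s \<longleftrightarrow> Q (s[i := [1]])"
  by (cases b) (auto simp: set_flag_def, (metis list_update_id)+)

section \<open>Dictionary search\<close>

text \<open>
  Stacks: \<open>0\<close> input and output, \<open>1\<close> reversed formula, \<open>2\<close> the part of \<open>1\<close> already scanned,
  \<open>3\<close> tally marks, \<open>4\<close> round counter, \<open>5\<close> dictionary, \<open>6\<close> the part of \<open>5\<close> already scanned,
  \<open>7\<close> current variable, \<open>8\<close> scratch space for \<open>7\<close>, \<open>9\<close> variables to be added to the dictionary;
  \<open>10\<close>-\<open>13\<close> are flags: clause blocked, unsatisfiable, mismatch, found.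

  The dictionary lists pairs of a variable and a tag: \<open>3\<close> forced true, \<open>4\<close> forced false,
  \<open>5\<close> already seen.
\<close>

definition dict :: "(nat \<times> nat) list \<Rightarrow> nat list" where
  "dict L = concat (map (\<lambda>(x, c). enc_nat x @ [c]) L)"

lemma dict_simps [simp]:
  "dict [] = []" "dict ((x, c) # L) = enc_nat x @ c # dict L" "dict (L @ L') = dict L @ dict L'"
  by (simp_all add: dict_def)

lemma dict_eq_Nil [simp]: "dict L = [] \<longleftrightarrow> L = []"
  by (cases L) auto

lemma enc_nat_digit: "d \<in> set (enc_nat x) \<Longrightarrow> d = 1 \<or> d = 2"
  using set_enc_nat by blast

lemma zero_notin_enc_nat [simp]: "0 \<notin> set (enc_nat x)"
  using enc_nat_digit by fastforce

lemma zero_notin_dict: "\<forall>(x, c)\<in>set L. 0 < c \<Longrightarrow> 0 \<notin> set (dict L)"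
  by (auto simp: dict_def)

abbreviation digits :: "nat set" where
  "digits \<equiv> {1, 2}"

abbreviation nonblank :: "nat set" where
  "nonblank \<equiv> {0<..}"

lemma subset_nonblank [simp]: "set w \<subseteq> nonblank \<longleftrightarrow> 0 \<notin> set w"
  by (auto intro: gr0I)

lemma peek_nonblank [simp]: "0 \<notin> set w \<Longrightarrow> 0 < peek w \<longleftrightarrow> w \<noteq> []"
  by (cases w) auto

text \<open>There is no early exit at a mismatch, as the whole name of the entry has to pass to
  stack 6 anyway. Matched digits of the sought variable go to stack 8, from where they are put
  back.\<close>

definition compare :: com where
  "compare = Loop 5 (\<lambda>h. h ! 5 \<in> digits)
     (Cond (\<lambda>h. h ! 7 = h ! 5) (Copy 7 8 ;; Pop 7) (set_flag 12) ;; Copy 5 6 ;; Pop 5)"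

fun cmp :: "nat list \<Rightarrow> nat list \<times> nat list \<times> bool \<Rightarrow> nat list \<times> nat list \<times> bool" where
  "cmp [] (x, x', e) = (x, x', e)"
| "cmp (d # ds) (x, x', e) =
     (if peek x = d then cmp ds (tl x, d # x', e) else cmp ds (x, x', True))"

lemma cmp_rev: "cmp ds (x, x', e) = (y, y', e') \<Longrightarrow> 0 \<notin> set ds \<Longrightarrow> rev y' @ y = rev x' @ x"
proof (induction ds arbitrary: x x' e)
  case (Cons d ds)
  then show ?case by (cases x) (auto split: if_splits)
qed auto

lemma cmp_mismatch: "cmp ds (x, x', True) = (y, y', e') \<Longrightarrow> e'"
  by (induction ds arbitrary: x x') (auto split: if_splits)

text \<open>As \<open>0 \<notin> set ds\<close>, an exhausted \<open>x\<close>, whose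
  \<open>peek\<close> is 0, mismatches every further digit. The opposite case, \<open>ds\<close>
  being a proper prefix of \<open>x\<close>, leaves \<open>y\<close> nonempty.\<close>

lemma cmp_eq:
  "cmp ds (x, x', e) = (y, y', e') \<Longrightarrow> 0 \<notin> set ds \<Longrightarrow> \<not> e' \<and> y = [] \<longleftrightarrow> \<not> e \<and> x = ds"
proof (induction ds arbitrary: x x' e)
  case (Cons d ds)
  then show ?case by (cases x) (auto split: if_splits dest: cmp_mismatch)
qed auto

lemma wp_compare:
  assumes "set ds \<subseteq> digits" "peek v \<notin> digits" "length (ds @ v) \<le> B"
    "cmp ds (x, x', e) = (y, y', e')"
    "Q [out, r, r', k, cn, v, rev ds @ t', y, y', z, n, u, flag e', f]"
  shows "wp B compare Q [out, r, r', k, cn, ds @ v, t', x, x', z, n, u, flag e, f]"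
  using assms
proof (induction ds arbitrary: t' x x' e)
  case Nil
  then show ?case unfolding compare_def by (intro wp_Loop_done) auto
next
  case (Cons d ds)
  show ?case
  proof (cases "peek x = d")
    case True
    have "wp B compare Q [out, r, r', k, cn, ds @ v, d # t', tl x, d # x', z, n, u, flag e, f]"
      using Cons.prems True by (intro Cons.IH) auto
    with True Cons.prems show ?thesis unfolding compare_def
      by (intro wp_Loop_step) auto
  next
    case False
    have "wp B compare Q [out, r, r', k, cn, ds @ v, d # t', x, x', z, n, u, flag True, f]"
      using Cons.prems False by (intro Cons.IH) auto
    with False Cons.prems show ?thesis unfolding compare_def
      by (intro wp_Loop_step) auto
  qed
qed

text \<open>Flag 12 concerns a single entry and is cleared before the next; flag 13 survives the
  search and is cleared by the caller. The scan goes on after a hit, so that stack 6 receives the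
  complete dictionary.\<close>

definition lookup_loop :: "nat \<Rightarrow> com" where
  "lookup_loop c = Loop 5 (\<lambda>h. h ! 5 \<in> nonblank)
     (compare ;;
      Cond (\<lambda>h. h ! 7 \<noteq> 0 \<or> h ! 5 \<noteq> c) (set_flag 12) Skip ;;
      Copy 5 6 ;; Pop 5 ;; mv 8 7 nonblank ;;
      Cond (\<lambda>h. h ! 12 = 0) (set_flag 13) (Pop 12))"

definition lookup :: "nat \<Rightarrow> com" where
  "lookup c = lookup_loop c ;; mv 6 5 nonblank"

lemma wp_lookup_loop:
  assumes "\<forall>(x, c)\<in>set L. 2 < c" "length (dict L) \<le> B" "length (enc_nat x) \<le> B"
    "Q [out, r, r', k, cn, [], rev (dict L) @ t', enc_nat x, [], y, n, u, [], flag (f \<or> (x, c) \<in> set L)]"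
  shows "wp B (lookup_loop c) Q
    [out, r, r', k, cn, dict L, t', enc_nat x, [], y, n, u, [], flag f]"
  using assms
proof (induction L arbitrary: t' f)
  case Nil
  then show ?case unfolding lookup_loop_def by (intro wp_Loop_done) auto
next
  case (Cons p L)
  obtain a d where p: "p = (a, d)" by force
  obtain w w' e where cmp: "cmp (enc_nat a) (enc_nat x, [], False) = (w, w', e)"
    by (metis prod_cases3)
  have w: "rev w' @ w = enc_nat x" using cmp_rev[OF cmp] by simp
  have e: "\<not> e \<and> w = [] \<longleftrightarrow> x = a" using cmp_eq[OF cmp] by (auto simp: enc_nat_inject)
  have z: "0 \<notin> set w" "0 \<notin> set w'" using zero_notin_enc_nat[of x] by (simp_all flip: w)
  have len: "length w' \<le> B" using Cons.prems(3) by (simp flip: w)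
  have pos: "0 < peek (enc_nat a @ d # dict L)"
    using Cons.prems p by (cases "enc_nat a") (use enc_nat_digit[of _ a] in fastforce)+
  have IH: "wp B (lookup_loop c) Q
      [out, r, r', k, cn, dict L, d # rev (enc_nat a) @ t', enc_nat x, [], y, n, u, [],
       flag (f \<or> (x, c) = p)]"
    using Cons.prems p by (intro Cons.IH) (auto simp: disj_ac)
  have d: "2 < d" using Cons.prems p by auto
  show ?case unfolding lookup_loop_def p dict_simps
    apply (rule wp_Loop_step)
    subgoal using pos by simp
    subgoal using Cons.prems p by simp
    unfolding wp_simps
    apply (rule wp_compare[where e = False, unfolded flag_simps(1), OF _ _ _ cmp])
    subgoal by (rule set_enc_nat)
    subgoal using d by simp
    subgoal using Cons.prems p by simp
    subgoal
      apply (cases "w \<noteq> [] \<or> d \<noteq> c")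
      subgoal
        using z d
        apply simp
        apply (rule wp_mv[where w = w' and v = "[]"])
        using z len w IH[unfolded lookup_loop_def] p e apply auto
        done
      subgoal
        using z d
        apply simp
        apply (rule wp_mv[where w = w' and v = "[]"])
        using z len w IH[unfolded lookup_loop_def] p e apply (auto split: if_splits)
        done
      done
    done
qed

lemma wp_lookup:
  assumes "\<forall>(x, c)\<in>set L. 2 < c" "length (dict L) \<le> B" "length (enc_nat x) \<le> B"
    "Q [out, r, r', k, cn, dict L, [], enc_nat x, [], y, n, u, [], flag ((x, c) \<in> set L)]"
  shows "wp B (lookup c) Q
    [out, r, r', k, cn, dict L, [], enc_nat x, [], y, n, u, [], []]"
proof -
  have "0 \<notin> set (dict L)" using assms(1) by (intro zero_notin_dict) auto
  then show ?thesis
    unfolding lookup_def wp_simps using assms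
    apply (rule_tac wp_lookup_loop[where f = False, unfolded flag_simps(1)])
       apply auto[3]
    apply (rule wp_mv[where w = "rev (dict L)" and v = "[]"])
           apply (auto simp: Suc_le_eq intro!: gr0I)
    done
qed

text \<open>Popping the digits, most significant first, reverses them again, so stack 7 receives
  \<open>enc_nat x\<close> itself. The copy on stack 2 preserves the formula.\<close>

definition getvar :: com where
  "getvar = Loop 1 (\<lambda>h. h ! 1 \<in> digits) (Copy 1 2 ;; Copy 1 7 ;; Pop 1)"

lemma wp_getvar:
  assumes "set ds \<subseteq> digits" "peek v \<notin> digits" "length (ds @ v) \<le> B"
    "Q [out, v, rev ds @ r', k, cn, t, t', rev ds @ x, x', y, n, u, e, f]"
  shows "wp B getvar Q [out, ds @ v, r', k, cn, t, t', x, x', y, n, u, e, f]"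
  using assms
proof (induction ds arbitrary: r' x)
  case Nil
  then show ?case unfolding getvar_def by (intro wp_Loop_done) auto
next
  case (Cons d ds)
  have "wp B getvar Q [out, ds @ v, d # r', k, cn, t, t', d # x, x', y, n, u, e, f]"
    using Cons.prems by (intro Cons.IH) auto
  with Cons.prems show ?case unfolding getvar_def
    by (intro wp_Loop_step) auto
qed

definition tag :: "bool \<Rightarrow> nat" where
  "tag b = (if b then 3 else 4)"

lemma tag_simps [simp]:
  "2 < tag b" "0 < tag b" "tag b \<noteq> 1" "tag b \<noteq> Suc 0" "tag b \<noteq> 2" "tag b \<noteq> 5" "5 \<noteq> tag b"
  "tag b = tag b' \<longleftrightarrow> b = b'"
  by (auto simp: tag_def)

text \<open>
  The formula is read from the end: a separator precedes its clause, and the digits of a variable,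
  now most significant first, precede the sign of the literal.
\<close>

definition rlit :: "literal \<Rightarrow> nat list" where
  "rlit = (\<lambda>(x, b). rev (enc_nat x) @ [tag b])"

definition rlits :: "clause \<Rightarrow> nat list" where
  "rlits C = concat (map rlit C)"

definition rcnf :: "cnf \<Rightarrow> nat list" where
  "rcnf Cs = concat (map (\<lambda>C. 5 # rlits C) Cs)"

lemma rlits_simps [simp]:
  "rlits [] = []" "rlits ((x, b) # C) = rev (enc_nat x) @ tag b # rlits C"
  "rlits (C @ D) = rlits C @ rlits D"
  by (simp_all add: rlits_def rlit_def)

lemma rcnf_simps [simp]: "rcnf [] = []" "rcnf (C # Cs) = 5 # rlits C @ rcnf Cs"
  by (simp_all add: rcnf_def)

lemma zero_notin_rlits [simp]: "0 \<notin> set (rlits C)"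
  by (auto simp: rlits_def rlit_def)

lemma zero_notin_rcnf [simp]: "0 \<notin> set (rcnf Cs)"
  by (auto simp: rcnf_def)

text \<open>The name of variable 0 is the empty word, so a literal may begin with its tag; hence 3
  and 4 besides the digits.\<close>

lemma peek_rlits: "peek (rlits C @ v) \<in> {1, 2, 3, 4}" if ne: "C \<noteq> []"
proof -
  obtain x b C' where C: "C = (x, b) # C'" using ne by (cases C) auto
  show ?thesis
  proof (cases "rev (enc_nat x)")
    case (Cons d ds)
    then have "d \<in> set (rev (enc_nat x))" by simp
    then have "d = 1 \<or> d = 2" using enc_nat_digit by simp
    then show ?thesis using Cons C by auto
  qed (simp add: C tag_def)
qed

lemma peek_rcnf [simp]: "peek (rcnf Cs) = 0 \<or> peek (rcnf Cs) = 5"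
  by (cases Cs) auto

section \<open>One pass of unit propagation\<close>

definition lit_step :: "bool \<Rightarrow> com" where
  "lit_step b = getvar ;;
     Cond (\<lambda>h. h ! 1 = tag b) (mv 7 9 nonblank ;; Push 9 (tag b))
       (lookup (tag b) ;; Cond (\<lambda>h. h ! 13 = 0) (set_flag 10) (Pop 13) ;; drop_all 7 nonblank) ;;
     Copy 1 2 ;; Pop 1"

definition wf_dict :: "(nat \<times> nat) list \<Rightarrow> bool" where
  "wf_dict L \<longleftrightarrow> (\<forall>(x, c)\<in>set L. 2 < c)"

lemma wf_dict_zero: "wf_dict L \<Longrightarrow> 0 \<notin> set (dict L)"
  by (rule zero_notin_dict) (auto simp: wf_dict_def)

text \<open>The conclusions of the clause read as an implication for the sign \<open>b\<close>. Its
  premises are the variables with the opposite sign, each required to have value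
  \<open>b\<close>.\<close>

definition heads :: "bool \<Rightarrow> clause \<Rightarrow> (nat \<times> nat) list" where
  "heads b C = map (\<lambda>(x, _). (x, tag b)) (filter (\<lambda>(_, b'). b' = b) C)"

text \<open>Some premise is not yet recorded as forced to \<open>b\<close>. Entries with the
  opposite tag are not consulted, which keeps the two signs independent.\<close>

definition blocked :: "bool \<Rightarrow> (nat \<times> nat) list \<Rightarrow> clause \<Rightarrow> bool" where
  "blocked b L C \<longleftrightarrow> (\<exists>(x, b')\<in>set C. b' \<noteq> b \<and> (x, tag b) \<notin> set L)"

lemma wp_lit_step:
  assumes "wf_dict L" "length (dict L) \<le> B" "length (rlits (p # C) @ v) \<le> B"
    "Q [out, rlits C @ v, rev (rlits [p]) @ r', k, cn, dict L, [], [], [],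
        rev (dict (ys @ heads b [p])), flag (n \<or> blocked b L [p]), u, [], []]"
  shows "wp B (lit_step b) Q
    [out, rlits (p # C) @ v, r', k, cn, dict L, [], [], [], rev (dict ys), flag n, u, [], []]"
proof -
  obtain x b' where p: "p = (x, b')" by force
  have len: "length (enc_nat x) \<le> B" "length (rlits C @ v) \<le> B" using assms(3) p by auto
  show ?thesis
    unfolding lit_step_def wp_simps p rlits_simps append_assoc append_Cons
    apply (rule wp_getvar)
    subgoal using set_enc_nat by simp
    subgoal by simp
    subgoal using assms(3) p by simp
    subgoal
      apply (cases "b' = b")
      subgoal
        apply simp
        apply (rule wp_mv[where w = "enc_nat x" and v = "[]"])
        using len assms(4) p apply (auto simp: heads_def blocked_def)
        done
      subgoal
        apply simp
        apply (rule wp_lookup[OF assms(1)[unfolded wf_dict_def] assms(2) len(1)])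
        apply (cases "(x, tag b) \<in> set L"; simp)
         apply (rule wp_drop_all[where w = "enc_nat x" and v = "[]"])
        using len assms(4) p apply (auto simp: heads_def blocked_def)[6]
        apply (rule wp_drop_all[where w = "enc_nat x" and v = "[]"])
        using len assms(4) p apply (auto simp: heads_def blocked_def)[6]
        done
      done
    done
qed

definition scan_clause :: "bool \<Rightarrow> com" where
  "scan_clause b = Loop 1 (\<lambda>h. h ! 1 \<in> {1, 2, 3, 4}) (lit_step b)"

lemma heads_Cons: "heads b (p # C) = heads b [p] @ heads b C"
  by (auto simp: heads_def)

lemma blocked_Cons: "blocked b L (p # C) \<longleftrightarrow> blocked b L [p] \<or> blocked b L C"
  by (auto simp: blocked_def)

lemma length_rlits_Cons: "length (rlits (p # C)) > length (rlits C)"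
  by (cases p) auto

lemma wp_scan_clause:
  assumes "wf_dict L" "length (dict L) \<le> B" "length (rlits C @ v) \<le> B" "peek v = 0 \<or> peek v = 5"
    "Q [out, v, rev (rlits C) @ r', k, cn, dict L, [], [], [],
        rev (dict (ys @ heads b C)), flag (n \<or> blocked b L C), u, [], []]"
  shows "wp B (scan_clause b) Q
    [out, rlits C @ v, r', k, cn, dict L, [], [], [], rev (dict ys), flag n, u, [], []]"
  using assms
proof (induction C arbitrary: r' ys n)
  case Nil
  then show ?case unfolding scan_clause_def
    by (intro wp_Loop_done) (auto simp: heads_def blocked_def)
next
  case (Cons p C)
  have len: "length (rlits C @ v) \<le> B"
    using Cons.prems(3) length_rlits_Cons[of C p] by simp
  have r': "rev (rlits C) @ rev (rlits [p]) @ r' = rev (rlits (p # C)) @ r'" by (cases p) simp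
  have IH: "wp B (scan_clause b) Q
    [out, rlits C @ v, rev (rlits [p]) @ r', k, cn, dict L, [], [], [],
     rev (dict (ys @ heads b [p])), flag (n \<or> blocked b L [p]), u, [], []]"
    apply (rule Cons.IH[OF Cons.prems(1,2) len Cons.prems(4)])
    using Cons.prems(5) unfolding heads_Cons[of b p C] blocked_Cons[of b L p C] r' disj_assoc append_assoc .
  show ?case
    unfolding scan_clause_def
    apply (rule wp_Loop_step)
    subgoal using peek_rlits[of "p # C" v] by (simp del: rlits_simps)
    subgoal using Cons.prems by simp
    apply (rule wp_lit_step)
    subgoal by (rule Cons.prems)
    subgoal by (rule Cons.prems)
    subgoal by (rule Cons.prems)
    using IH length_rlits_Cons[of C p] apply (simp add: scan_clause_def del: rlits_simps)
    done
qed

definition clause_step :: "bool \<Rightarrow> com" where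
  "clause_step b = Copy 1 2 ;; Pop 1 ;; scan_clause b ;;
     Cond (\<lambda>h. h ! 10 = 0) (Cond (\<lambda>h. h ! 9 = 0) (set_flag 11) (mv 9 5 nonblank))
       (drop_all 9 nonblank ;; Pop 10)"

text \<open>Heads are recorded even if already present, so a pass may lengthen the dictionary by the
  length of the formula every time.\<close>

definition propagate :: "bool \<Rightarrow> clause \<Rightarrow> (nat \<times> nat) list \<Rightarrow> (nat \<times> nat) list" where
  "propagate b C L = (if blocked b L C then L else heads b C @ L)"

definition conflict :: "bool \<Rightarrow> (nat \<times> nat) list \<Rightarrow> clause \<Rightarrow> bool" where
  "conflict b L C \<longleftrightarrow> \<not> blocked b L C \<and> heads b C = []"

lemma wf_heads [simp]: "wf_dict (heads b C)"
  by (auto simp: wf_dict_def heads_def)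

lemma wf_propagate: "wf_dict L \<Longrightarrow> wf_dict (propagate b C L)"
  using wf_heads[of b C] by (auto simp: propagate_def wf_dict_def)

lemma length_heads: "length (dict (heads b C)) \<le> length (rlits C)"
  by (induction C) (auto simp: heads_def)

lemma length_propagate: "length (dict (propagate b C L)) \<le> length (rlits C) + length (dict L)"
  using length_heads[of b C] by (auto simp: propagate_def)

lemma peek_eq_0 [simp]: "0 \<notin> set w \<Longrightarrow> peek w = 0 \<longleftrightarrow> w = []"
  by (cases w) auto

lemma wp_clause_step:
  assumes "wf_dict L" "length (dict L) \<le> B" "length (5 # rlits C @ v) \<le> B" "peek v = 0 \<or> peek v = 5"
    "Q [out, v, rev (5 # rlits C) @ r', k, cn, dict (propagate b C L), [], [], [], [], [],
        flag (u \<or> conflict b L C), [], []]"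
  shows "wp B (clause_step b) Q
    [out, 5 # rlits C @ v, r', k, cn, dict L, [], [], [], [], [], flag u, [], []]"
proof -
  have len: "length (dict (heads b C)) \<le> B" using length_heads[of b C] assms(3) by simp
  have z: "0 \<notin> set (dict (heads b C))" by (simp add: wf_dict_zero)
  show ?thesis
    unfolding clause_step_def
    apply simp
    apply (rule wp_scan_clause[where ys = "[]" and n = False, simplified])
    using assms apply (simp_all)[4]
    apply (cases "blocked b L C"; simp)
    subgoal
      apply (rule wp_drop_all[where w = "rev (dict (heads b C))" and v = "[]"])
      using len z assms(5) apply (auto simp: propagate_def conflict_def)
      done
    apply (cases "heads b C = []"; simp add: z)
    subgoal using assms(5) by (auto simp: propagate_def conflict_def)
    subgoal
      apply (rule wp_mv[where w = "rev (dict (heads b C))" and v = "[]"])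
      using len z assms(5) apply (auto simp: propagate_def conflict_def)
      done
    done
qed

definition pass_loop :: "bool \<Rightarrow> com" where
  "pass_loop b = Loop 1 (\<lambda>h. h ! 1 = 5) (clause_step b)"

definition pass :: "bool \<Rightarrow> com" where
  "pass b = pass_loop b ;; mv 2 1 nonblank"

fun propagates :: "bool \<Rightarrow> cnf \<Rightarrow> (nat \<times> nat) list \<times> bool \<Rightarrow> (nat \<times> nat) list \<times> bool" where
  "propagates b [] (L, u) = (L, u)"
| "propagates b (C # Cs) (L, u) = propagates b Cs (propagate b C L, u \<or> conflict b L C)"

lemma wp_pass_loop:
  assumes "wf_dict L" "length (dict L) + length (rcnf Cs) \<le> B" "propagates b Cs (L, u) = (L', u')"
    "Q [out, [], rev (rcnf Cs) @ r', k, cn, dict L', [], [], [], [], [], flag u', [], []]"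
  shows "wp B (pass_loop b) Q
    [out, rcnf Cs, r', k, cn, dict L, [], [], [], [], [], flag u, [], []]"
  using assms
proof (induction Cs arbitrary: L u r')
  case Nil
  then show ?case unfolding pass_loop_def by (intro wp_Loop_done) auto
next
  case (Cons C Cs)
  have "wp B (pass_loop b) Q
    [out, rcnf Cs, rev (5 # rlits C) @ r', k, cn, dict (propagate b C L), [], [], [], [], [],
     flag (u \<or> conflict b L C), [], []]"
    using Cons.prems length_propagate[of b C L] by (intro Cons.IH) (auto intro: wf_propagate)
  then show ?case
    unfolding pass_loop_def
    apply (intro wp_Loop_step)
    subgoal by simp
    subgoal using Cons.prems by simp
    unfolding rcnf_simps
    apply (rule wp_clause_step)
    subgoal by (rule Cons.prems)
    subgoal using Cons.prems by simp
    subgoal using Cons.prems by simp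
    subgoal by (rule peek_rcnf)
    apply (simp add: pass_loop_def)
    done
qed

lemma propagates_wf: "propagates b Cs (L, u) = (L', u') \<Longrightarrow> wf_dict L \<Longrightarrow> wf_dict L'"
  by (induction Cs arbitrary: L u) (auto intro: wf_propagate)

lemma propagates_length:
  "propagates b Cs (L, u) = (L', u') \<Longrightarrow> length (dict L') \<le> length (dict L) + length (rcnf Cs)"
proof (induction Cs arbitrary: L u)
  case (Cons C Cs)
  then show ?case using length_propagate[of b C L] by fastforce
qed auto

lemma wp_pass:
  assumes "wf_dict L" "length (dict L) + length (rcnf Cs) \<le> B" "propagates b Cs (L, u) = (L', u')"
    "Q [out, rcnf Cs, [], k, cn, dict L', [], [], [], [], [], flag u', [], []]"
  shows "wp B (pass b) Q
    [out, rcnf Cs, [], k, cn, dict L, [], [], [], [], [], flag u, [], []]"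
  unfolding pass_def wp_simps
  apply (rule wp_pass_loop[OF assms(1-3)])
  apply (rule wp_mv[where w = "rev (rcnf Cs)" and v = "[]"])
  using assms by auto

section \<open>Reducing the formula to one literal per variable\<close>

definition dedup_loop :: com where
  "dedup_loop = Loop 1 (\<lambda>h. h ! 1 \<in> nonblank)
     (Cond (\<lambda>h. h ! 1 = 5) (Pop 1)
        (getvar ;; lookup 5 ;;
         Cond (\<lambda>h. h ! 13 = 0)
           (Copy 1 2 ;; mv 7 8 nonblank ;; Push 5 5 ;; mv 8 5 nonblank)
           (Pop 13 ;; drop_all 2 digits ;; drop_all 7 nonblank) ;;
         Pop 1))"

definition dedup :: com where
  "dedup = dedup_loop ;; mv 2 1 nonblank"

text \<open>\<open>V\<close> collects the variables met so far, which the machine marks with tag 5.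
  The output format demands exactly one literal per variable; the sign retained here is overwritten
  later by \<open>lit_value\<close>.\<close>

fun keep :: "nat set \<Rightarrow> clause \<Rightarrow> clause" where
  "keep V [] = []"
| "keep V ((x, b) # C) = (if x \<in> V then keep V C else (x, b) # keep (insert x V) C)"

lemma distinct_keep: "distinct (map fst (keep V C)) \<and> fst ` set (keep V C) = fst ` set C - V"
  by (induction V C rule: keep.induct) auto

lemma length_keep: "length (rlits (keep V C)) \<le> length (rlits C)"
proof (induction V C rule: keep.induct)
  case (2 V x b C)
  then show ?case by auto
qed auto

definition seen :: "(nat \<times> nat) list \<Rightarrow> nat set" where
  "seen L = {x. (x, 5) \<in> set L}"

text \<open>On stack 2 a repeated name lies above a tag or the bottom, so
  \<open>drop_all 2 digits\<close> undoes exactly the last copy made by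
  \<open>getvar\<close>.\<close>

lemma peek_rev_rlits: "peek (rev (rlits C)) \<notin> digits"
  by (cases C rule: rev_cases) (auto simp: split_paired_all)

text \<open>One loop handles literals and separators alike, so the treatment of a clause ends in the
  same loop on the rest \<open>v\<close>. The new dictionary is described only through the
  properties that matter later.\<close>

lemma wp_dedup_clause:
  assumes "wf_dict L" "length (dict L) + length (rlits C @ v) \<le> B" "length (rlits C @ v) + length (rlits D) \<le> B"
    "\<And>L'. wf_dict L' \<Longrightarrow> \<forall>x b. (x, tag b) \<in> set L' \<longleftrightarrow> (x, tag b) \<in> set L \<Longrightarrow>
      seen L' = seen L \<union> fst ` set C \<Longrightarrow> length (dict L') \<le> length (dict L) + length (rlits C) \<Longrightarrow>
      wp B dedup_loop Q
      [out, v, rev (rlits (D @ keep (seen L) C)), k, cn, dict L', [], [], [], [], [], u, [], []]"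
  shows "wp B dedup_loop Q
    [out, rlits C @ v, rev (rlits D), k, cn, dict L, [], [], [], [], [], u, [], []]"
  using assms
proof (induction C arbitrary: D L)
  case Nil
  then show ?case by auto
next
  case (Cons p C)
  obtain x b where p: "p = (x, b)" by force
  have len: "length (enc_nat x) \<le> B" "length (rlits C @ v) \<le> B" "length (dict L) \<le> B"
    "length (rev (enc_nat x) @ rev (rlits D)) \<le> B"
    "length (rev (enc_nat x) @ tag b # rlits C @ v) \<le> B"
    using Cons.prems(2,3) p by auto
  have hd: "peek (rlits (p # C) @ v) \<in> {1, 2, 3, 4}" by (rule peek_rlits) simp
  define L1 where "L1 = (if x \<in> seen L then L else (x, 5) # L)"
  define D1 where "D1 = (if x \<in> seen L then D else D @ [(x, b)])"
  have IH: "wp B dedup_loop Q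
    [out, rlits C @ v, rev (rlits D1), k, cn, dict L1, [], [], [], [], [], u, [], []]"
  proof (rule Cons.IH)
    show "wf_dict L1" using Cons.prems(1) by (auto simp: L1_def wf_dict_def)
    show "length (dict L1) + length (rlits C @ v) \<le> B"
      "length (rlits C @ v) + length (rlits D1) \<le> B"
      using Cons.prems(2,3) p by (auto simp: L1_def D1_def)
    fix L'
    assume "wf_dict L'" "\<forall>x b. ((x, tag b) \<in> set L') = ((x, tag b) \<in> set L1)"
      "seen L' = seen L1 \<union> fst ` set C" "length (dict L') \<le> length (dict L1) + length (rlits C)"
    moreover have "seen L1 = insert x (seen L)" by (auto simp: L1_def seen_def)
    moreover have "D1 @ keep (insert x (seen L)) C = D @ keep (seen L) (p # C)"
      by (auto simp: D1_def p insert_absorb)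
    ultimately show "wp B dedup_loop Q
      [out, v, rev (rlits (D1 @ keep (seen L1) C)), k, cn, dict L', [], [], [], [], [], u, [], []]"
      using Cons.prems(4)[of L'] p by (auto simp: L1_def split: if_splits)
  qed
  show ?case
    unfolding dedup_loop_def
    apply (rule wp_Loop_step)
    subgoal using hd by (auto simp del: rlits_simps)
    subgoal using Cons.prems(3) by simp
    unfolding wp_simps
    apply (subst if_not_P)
    subgoal using hd by (auto simp del: rlits_simps)
    unfolding p rlits_simps append_assoc append_Cons
    apply (rule wp_getvar)
    subgoal using set_enc_nat by simp
    subgoal by simp
    subgoal using len by simp
    unfolding rev_rev_ident append_Nil2
    apply (rule wp_lookup[OF Cons.prems(1)[unfolded wf_dict_def] len(3,1)])
    apply (cases "(x, 5) \<in> set L"; simp)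
    subgoal
      apply (rule wp_drop_all[where w = "enc_nat x" and v = "rev (rlits D)"])
      subgoal by simp
      subgoal using set_enc_nat by simp
      subgoal using peek_rev_rlits by simp
      subgoal by simp
      subgoal using len by simp
      apply simp
      apply (rule wp_drop_all[where w = "enc_nat x" and v = "[]"])
      using len IH apply (auto simp: L1_def D1_def seen_def dedup_loop_def)
      done
    subgoal
      apply (rule wp_mv[where w = "enc_nat x" and v = "[]"])
      using len apply (simp_all)[7]
      apply simp
      apply (rule wp_mv[where w = "rev (enc_nat x)" and v = "[]"])
      using len IH apply (auto simp: L1_def D1_def seen_def dedup_loop_def)
      done
    done
qed

lemma wp_dedup_loop:
  assumes "wf_dict L" "length (dict L) + length (rcnf Cs) \<le> B" "length (rcnf Cs) + length (rlits D) \<le> B"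
    "\<And>L'. wf_dict L' \<Longrightarrow> \<forall>x b. (x, tag b) \<in> set L' \<longleftrightarrow> (x, tag b) \<in> set L \<Longrightarrow>
      length (dict L') \<le> length (dict L) + length (rcnf Cs) \<Longrightarrow>
      Q [out, [], rev (rlits (D @ keep (seen L) (concat Cs))), k, cn, dict L', [], [], [], [], [], u, [], []]"
  shows "wp B dedup_loop Q
    [out, rcnf Cs, rev (rlits D), k, cn, dict L, [], [], [], [], [], u, [], []]"
  using assms
proof (induction Cs arbitrary: D L)
  case Nil
  then show ?case unfolding dedup_loop_def by (intro wp_Loop_done) auto
next
  case (Cons C Cs)
  have keep_append: "keep V (C @ E) = keep V C @ keep (V \<union> fst ` set C) E" for V E
    by (induction V C rule: keep.induct) (auto simp: insert_absorb)
  have "wp B dedup_loop Q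
    [out, rlits C @ rcnf Cs, rev (rlits D), k, cn, dict L, [], [], [], [], [], u, [], []]"
  proof (rule wp_dedup_clause)
    fix L' assume L': "wf_dict L'" "\<forall>x b. (x, tag b) \<in> set L' \<longleftrightarrow> (x, tag b) \<in> set L"
      "seen L' = seen L \<union> fst ` set C" "length (dict L') \<le> length (dict L) + length (rlits C)"
    show "wp B dedup_loop Q
      [out, rcnf Cs, rev (rlits (D @ keep (seen L) C)), k, cn, dict L', [], [], [], [], [], u, [], []]"
    proof (rule Cons.IH)
      show "wf_dict L'" by (rule L')
      show "length (dict L') + length (rcnf Cs) \<le> B" using Cons.prems(2) L'(4) by simp
      show "length (rcnf Cs) + length (rlits (D @ keep (seen L) C)) \<le> B"
        using Cons.prems(3) length_keep[of "seen L" C] by simp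
    qed (use Cons.prems(4) L' in \<open>auto simp: keep_append simp del: rlits_simps\<close>)
  qed (use Cons.prems in auto)
  with Cons.prems show ?case
    unfolding dedup_loop_def by (intro wp_Loop_step) auto
qed

lemma length_rlits_concat: "length (rlits (concat Cs)) \<le> length (rcnf Cs)"
  by (induction Cs) auto

lemma wp_dedup:
  assumes "wf_dict L" "seen L = {}" "length (dict L) + length (rcnf Cs) \<le> B"
    "\<And>L'. wf_dict L' \<Longrightarrow> \<forall>x b. (x, tag b) \<in> set L' \<longleftrightarrow> (x, tag b) \<in> set L \<Longrightarrow>
      length (dict L') \<le> length (dict L) + length (rcnf Cs) \<Longrightarrow>
      Q [out, rlits (keep {} (concat Cs)), [], k, cn, dict L', [], [], [], [], [], u, [], []]"
  shows "wp B dedup Q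
    [out, rcnf Cs, [], k, cn, dict L, [], [], [], [], [], u, [], []]"
proof -
  have len: "length (rlits (keep {} (concat Cs))) \<le> B"
    using assms(3) length_keep[of "{}" "concat Cs"] length_rlits_concat[of Cs] by simp
  show ?thesis
    unfolding dedup_def wp_simps
    apply (rule wp_dedup_loop[where D = "[]", simplified])
    using assms apply simp_all[3]
    apply (rule wp_mv[where w = "rev (rlits (keep {} (concat Cs)))" and v = "[]"])
    using assms len by auto
qed

section \<open>Writing the models\<close>

definition emit :: "bool \<Rightarrow> com" where
  "emit b = getvar ;; Copy 1 2 ;; Pop 1 ;; lookup (tag b) ;; mv 7 8 nonblank ;; mv 8 0 nonblank ;;
     Cond (\<lambda>h. h ! 13 = 0) (Push 0 (tag (\<not> b))) (Push 0 (tag b) ;; Pop 13)"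

definition emit_loop :: "bool \<Rightarrow> com" where
  "emit_loop b = Loop 1 (\<lambda>h. h ! 1 \<in> nonblank) (emit b)"

text \<open>The output stack is built from its end: first the terminator 5, then for each literal
  the digits and on top of them the sign. Hence the reversed list in the specification.\<close>

definition write_model :: "bool \<Rightarrow> com" where
  "write_model b = Push 0 5 ;; emit_loop b ;; mv 2 1 nonblank"

definition lit_value :: "bool \<Rightarrow> (nat \<times> nat) list \<Rightarrow> literal \<Rightarrow> literal" where
  "lit_value b L = (\<lambda>(x, _). (x, (x, tag b) \<in> set L \<longleftrightarrow> b))"

lemma enc_literal_tag: "enc_literal (x, b) = tag b # enc_nat x"
  by (simp add: enc_literal_def tag_def)

lemma wp_emit_loop:
  assumes "wf_dict L" "length (dict L) \<le> B" "length (rlits D) \<le> B"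
    "Q [concat (map enc_literal (rev (map (lit_value b L) D))) @ out, [], rev (rlits D) @ r', k, cn, dict L,
        [], [], [], [], [], u, [], []]"
  shows "wp B (emit_loop b) Q
    [out, rlits D, r', k, cn, dict L, [], [], [], [], [], u, [], []]"
  using assms
proof (induction D arbitrary: out r')
  case Nil
  then show ?case unfolding emit_loop_def by (intro wp_Loop_done) auto
next
  case (Cons p D)
  obtain x b' where p: "p = (x, b')" by force
  have len: "length (enc_nat x) \<le> B" "length (rlits D) \<le> B" using Cons.prems(3) p by auto
  have IH: "wp B (emit_loop b) Q
    [enc_literal (lit_value b L p) @ out, rlits D, rev (rlits [p]) @ r', k, cn, dict L, [], [], [], [], [],
     u, [], []]"
    using Cons.prems p len by (intro Cons.IH) auto
  show ?case
    unfolding emit_loop_def p rlits_simps emit_def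
    apply (rule wp_Loop_step)
    subgoal using peek_rlits[of "p # D" "[]"] p by auto
    subgoal using Cons.prems p by simp
    unfolding wp_simps
    apply (rule wp_getvar)
    subgoal using set_enc_nat by simp
    subgoal by simp
    subgoal using Cons.prems(3) p by simp
    apply simp
    apply (rule wp_lookup[OF Cons.prems(1)[unfolded wf_dict_def] Cons.prems(2) len(1)])
    apply (rule wp_mv[where w = "enc_nat x" and v = "[]"])
    using len apply (simp_all)[7]
    apply simp
    apply (rule wp_mv[where w = "rev (enc_nat x)" and v = "[]"])
    using len apply (simp_all)[7]
    using IH apply (cases b)
    apply (auto simp: p emit_loop_def emit_def lit_value_def enc_literal_tag)
    done
qed

lemma wp_write_model:
  assumes "wf_dict L" "length (dict L) \<le> B" "length (rlits D) \<le> B"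
    "Q [enc_literals (rev (map (lit_value b L) D)) @ out, rlits D, [], k, cn, dict L,
        [], [], [], [], [], u, [], []]"
  shows "wp B (write_model b) Q
    [out, rlits D, [], k, cn, dict L, [], [], [], [], [], u, [], []]"
  unfolding write_model_def
  apply simp
  apply (rule wp_emit_loop[OF assms(1-3)])
  apply (rule wp_mv[where w = "rev (rlits D)" and v = "[]"])
  using assms by (auto simp: enc_literals_def)

section \<open>The complete program\<close>

definition rounds_loop :: com where
  "rounds_loop = Loop 4 (\<lambda>h. h ! 4 \<in> nonblank) (Pop 4 ;; pass True ;; pass False)"

definition write_loop :: com where
  "write_loop = Loop 3 (\<lambda>h. h ! 3 \<in> nonblank)
     (Pop 3 ;; write_model True ;; Cond (\<lambda>h. h ! 3 = 0) Skip (Pop 3 ;; write_model False))"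

text \<open>Reversing the input brings the tally marks to the top of stack 1, where
  \<open>mv 1 3 {6}\<close> takes them off. On stack 4 only the height matters: it is the number of
  rounds.\<close>

definition read_loop :: com where
  "read_loop = Loop 0 (\<lambda>h. h ! 0 \<in> nonblank) (Copy 0 1 ;; Copy 0 4 ;; Pop 0)"

definition main :: com where
  "main = read_loop ;; mv 1 3 {6} ;; rounds_loop ;;
     Cond (\<lambda>h. h ! 11 = 0) (dedup ;; write_loop) (Push 0 7)"

fun rounds :: "nat \<Rightarrow> cnf \<Rightarrow> (nat \<times> nat) list \<times> bool \<Rightarrow> (nat \<times> nat) list \<times> bool" where
  "rounds 0 Cs r = r"
| "rounds (Suc n) Cs r = rounds n Cs (propagates False Cs (propagates True Cs r))"

lemma wp_rounds_loop:
  assumes "wf_dict L" "length (dict L) + 2 * length cn * length (rcnf Cs) + length (rcnf Cs) \<le> B" "length cn \<le> B"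
    "0 \<notin> set cn" "rounds (length cn) Cs (L, u) = (L', u')"
    "wf_dict L' \<Longrightarrow> length (dict L') \<le> length (dict L) + 2 * length cn * length (rcnf Cs) \<Longrightarrow>
     Q [out, rcnf Cs, [], k, [], dict L', [], [], [], [], [], flag u', [], []]"
  shows "wp B rounds_loop Q
    [out, rcnf Cs, [], k, cn, dict L, [], [], [], [], [], flag u, [], []]"
  using assms
proof (induction cn arbitrary: L u)
  case Nil
  then show ?case unfolding rounds_loop_def by (intro wp_Loop_done) auto
next
  case (Cons a cn)
  obtain L1 u1 where 1: "propagates True Cs (L, u) = (L1, u1)" by force
  obtain L2 u2 where 2: "propagates False Cs (L1, u1) = (L2, u2)" by force
  have L1: "wf_dict L1" "length (dict L1) \<le> length (dict L) + length (rcnf Cs)"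
    using propagates_wf[OF 1] propagates_length[OF 1] Cons.prems(1) by auto
  have L2: "wf_dict L2" "length (dict L2) \<le> length (dict L) + 2 * length (rcnf Cs)"
    using propagates_wf[OF 2] propagates_length[OF 2] L1 by auto
  have IH: "wp B rounds_loop Q
    [out, rcnf Cs, [], k, cn, dict L2, [], [], [], [], [], flag u2, [], []]"
    using Cons.prems L2 1 2 by (intro Cons.IH) (auto simp: algebra_simps)
  show ?case
    unfolding rounds_loop_def
    apply (rule wp_Loop_step)
    subgoal using Cons.prems(4) by simp
    subgoal using Cons.prems(3) by simp
    apply simp
    apply (rule wp_pass[OF Cons.prems(1) _ 1])
    subgoal using Cons.prems(2) by simp
    apply (rule wp_pass[OF L1(1) _ 2])
    subgoal using Cons.prems(2) L1(2) by simp
    using IH by (simp add: rounds_loop_def)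
qed

text \<open>Later models are written in front of earlier ones, so the pair of the first iteration
  comes last; an odd mark left over yields a single model for \<open>True\<close>.\<close>

fun alternate :: "nat \<Rightarrow> bool list" where
  "alternate 0 = []"
| "alternate (Suc 0) = [True]"
| "alternate (Suc (Suc n)) = alternate n @ [False, True]"

lemma wp_write_loop:
  assumes "wf_dict L" "length (dict L) \<le> B" "length (rlits D) \<le> B" "n \<le> B"
    "\<And>s. hd s = enc_cnf (map (\<lambda>b. rev (map (lit_value b L) D)) (alternate n) @ lss) \<Longrightarrow> Q s"
  shows "wp B write_loop Q
    [enc_cnf lss, rlits D, [], replicate n 6, cn, dict L, [], [], [], [], [], u, [], []]"
  using assms
proof (induction n arbitrary: lss rule: alternate.induct)
  case 1
  then show ?case unfolding write_loop_def by (intro wp_Loop_done) auto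
next
  case 2
  show ?case
    unfolding write_loop_def
    apply (rule wp_Loop_step)
    subgoal by simp
    subgoal using 2 by simp
    apply simp
    apply (rule wp_write_model)
    using 2 apply (auto intro!: wp_Loop_done simp: enc_cnf_def)
    done
next
  case (3 n)
  let ?A = "\<lambda>b. rev (map (lit_value b L) D)"
  have IH: "wp B write_loop Q
    [enc_cnf (?A False # ?A True # lss), rlits D, [], replicate n 6, cn, dict L, [], [], [], [], [], u, [], []]"
    using "3.prems" by (intro "3.IH") auto
  show ?case
    unfolding write_loop_def
    apply (rule wp_Loop_step)
    subgoal by simp
    subgoal using "3.prems" by simp
    apply simp
    apply (rule wp_write_model)
    using "3.prems" apply simp_all[3]
    apply simp
    apply (rule wp_write_model)
    using "3.prems" IH apply (auto simp: enc_cnf_def write_loop_def)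
    done
qed

lemma wp_read_loop:
  assumes "0 \<notin> set w" "length w \<le> B"
    "Q [[], rev w @ r, r', k, rev w @ cn, t, t', x, x', y, n, u, e, f]"
  shows "wp B read_loop Q [w, r, r', k, cn, t, t', x, x', y, n, u, e, f]"
  using assms
proof (induction w arbitrary: r cn)
  case Nil
  then show ?case unfolding read_loop_def by (intro wp_Loop_done) auto
next
  case (Cons a w)
  have "wp B read_loop Q [w, a # r, r', k, a # cn, t, t', x, x', y, n, u, e, f]"
    using Cons.prems by (intro Cons.IH) auto
  with Cons.prems show ?case unfolding read_loop_def
    by (intro wp_Loop_step) auto
qed

lemma rev_enc_cnf: "rev (enc_cnf \<phi>) = rcnf (rev (map rev \<phi>))"
proof -
  have "rev (enc_literals ls) = 5 # rlits (rev ls)" for ls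
    by (induction ls) (auto simp: enc_literals_def enc_literal_tag)
  then show ?thesis
    by (induction \<phi>) (auto simp: enc_cnf_def rcnf_def)
qed

lemma zero_notin_enc_cnf [simp]: "0 \<notin> set (enc_cnf \<phi>)"
  using zero_notin_rcnf[of "rev (map rev \<phi>)"] by (simp flip: rev_enc_cnf)

text \<open>There are \<open>2 * N\<close> passes, each adding at most \<open>N\<close> symbols to
  the dictionary; the linear term leaves room for the formula and the marks of seen
  variables.\<close>

definition bound :: "nat \<Rightarrow> nat" where
  "bound N = 2 * N * N + 2 * N"

lemma enc_cnf_Nil: "enc_cnf [] = []"
  by (simp add: enc_cnf_def)

lemma wp_main:
  assumes "N = length (enc_instance \<phi> k)" "Cs = rev (map rev \<phi>)" "rounds N Cs ([], False) = (L, u)"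
    "seen L = {}"
    "\<And>s L'. \<not> u \<Longrightarrow> \<forall>x b. (x, tag b) \<in> set L' \<longleftrightarrow> (x, tag b) \<in> set L \<Longrightarrow>
       hd s = enc_cnf (map (\<lambda>b. rev (map (lit_value b L') (keep {} (concat Cs)))) (alternate k)) \<Longrightarrow> Q s"
    "\<And>s. u \<Longrightarrow> hd s = [7] \<Longrightarrow> Q s"
  shows "wp (bound N) main Q
    [enc_instance \<phi> k, [], [], [], [], [], [], [], [], [], [], [], [], []]"
proof -
  let ?w = "enc_instance \<phi> k"
  have rev: "rev ?w = replicate k 6 @ rcnf Cs"
    by (simp add: enc_instance_def rev_enc_cnf assms(2))
  have z: "0 \<notin> set ?w" by (simp add: enc_instance_def)
  have N: "N = k + length (rcnf Cs)" using arg_cong[OF rev, of length] assms(1) by simp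
  have "2 * N * length (rcnf Cs) \<le> 2 * N * N" using N by (intro mult_le_mono2) simp
  then have b: "N \<le> bound N" "2 * N * length (rcnf Cs) + 2 * length (rcnf Cs) \<le> bound N"
    unfolding bound_def using N by linarith+
  have len: "length (rlits (keep {} (concat Cs))) \<le> bound N"
    using length_keep[of "{}" "concat Cs"] length_rlits_concat[of Cs] b(1) N by simp
  show ?thesis
    unfolding main_def wp_simps
    apply (rule wp_read_loop)
    subgoal by (rule z)
    subgoal using b assms(1) by simp
    unfolding rev append_Nil2
    apply (rule wp_mv[where w = "replicate k 6" and v = "rcnf Cs"])
    subgoal by simp
    subgoal by auto
    subgoal using peek_rcnf[of Cs] by auto
    subgoal by simp
    subgoal by simp
    subgoal by simp
    subgoal using b N by simp
    apply simp
    apply (rule wp_rounds_loop[where L = "[]" and u = False and L' = L and u' = u, simplified])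
    subgoal by (simp add: wf_dict_def)
    subgoal using b N by simp
    subgoal using b N by simp
    subgoal by simp
    subgoal using assms(3) N by simp
    apply (cases u; simp)
    subgoal using assms(6) by simp
    subgoal
      apply (rule wp_dedup)
      subgoal by simp
      subgoal by (rule assms(4))
      subgoal using b N by simp
      subgoal for L'
        apply (rule wp_write_loop[where lss = "[]", unfolded enc_cnf_Nil append_Nil2])
        subgoal by simp
        subgoal using b N by simp
        subgoal using len by simp
        subgoal using b N by simp
        subgoal using assms(5) by simp
        done
      done
    done
qed

section \<open>Correctness\<close>

definition forced :: "bool \<Rightarrow> (nat \<times> nat) list \<Rightarrow> nat set" where
  "forced b L = {x. (x, tag b) \<in> set L}"

text \<open>Requiring each tag to be some \<open>tag b\<close> also excludes the mark 5, which gives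
  the initial condition of the deduplication.\<close>

definition sound :: "cnf \<Rightarrow> (nat \<times> nat) list \<Rightarrow> bool" where
  "sound \<phi> L \<longleftrightarrow> (\<forall>(x, c)\<in>set L. x \<in> vars \<phi> \<and> (\<exists>b. c = tag b \<and> (\<forall>\<alpha>\<in>sat_assignments \<phi>. \<alpha> x = Some b)))"

text \<open>Closure and absence of conflict in one condition: a clause whose premises hold must have
  a conclusion, and its conclusions must lie in \<open>X\<close>.\<close>

definition closed_under :: "bool \<Rightarrow> nat set \<Rightarrow> cnf \<Rightarrow> bool" where
  "closed_under b X \<phi> \<longleftrightarrow> (\<forall>C\<in>set \<phi>. (\<forall>x. (x, \<not> b) \<in> set C \<longrightarrow> x \<in> X) \<longrightarrow>
     (\<exists>x. (x, b) \<in> set C) \<and> (\<forall>x. (x, b) \<in> set C \<longrightarrow> x \<in> X))"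

lemma blocked_iff: "blocked b L C \<longleftrightarrow> (\<exists>x. (x, \<not> b) \<in> set C \<and> x \<notin> forced b L)"
proof
  assume "blocked b L C"
  then obtain x b' where "(x, b') \<in> set C" "b' \<noteq> b" "x \<notin> forced b L"
    by (auto simp: blocked_def forced_def)
  moreover from this have "b' = (\<not> b)" by auto
  ultimately show "\<exists>x. (x, \<not> b) \<in> set C \<and> x \<notin> forced b L" by blast
next
  assume "\<exists>x. (x, \<not> b) \<in> set C \<and> x \<notin> forced b L"
  then obtain x where "(x, \<not> b) \<in> set C" "x \<notin> forced b L" by blast
  then show "blocked b L C"
    unfolding blocked_def by (intro bexI[of _ "(x, \<not> b)"]) (simp_all add: forced_def)
qed

lemma heads_eq_Nil: "heads b C = [] \<longleftrightarrow> (\<forall>x. (x, b) \<notin> set C)"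
  by (auto simp: heads_def filter_empty_conv)

lemma set_heads: "set (heads b C) = {(x, tag b) |x. (x, b) \<in> set C}"
  by (auto simp: heads_def)

lemma double_horn_unique:
  assumes "double_horn \<phi>" "C \<in> set \<phi>" "(x, b) \<in> set C" "(y, b) \<in> set C"
  shows "x = y"
proof -
  have "{x. (x, b) \<in> set C} \<subseteq> fst ` set C" by force
  then have "finite {x. (x, b) \<in> set C}" by (rule finite_subset) simp
  moreover have "card {x. (x, b) \<in> set C} \<le> 1"
    using assms(1,2) by (cases b) (auto simp: double_horn_def)
  ultimately show ?thesis using assms(3,4) by (auto simp: card_le_Suc0_iff_eq)
qed

text \<open>All literals of sign \<open>\<not> b\<close> are false in every model, so the clause is
  satisfied by one of sign \<open>b\<close>. With a unique head this forces the head; without a head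
  it refutes the formula.\<close>

lemma model_unblocked:
  assumes "sound \<phi> L" "C \<in> set \<phi>" "\<not> blocked b L C" "\<alpha> \<in> sat_assignments \<phi>"
  obtains y where "(y, b) \<in> set C" "\<alpha> y = Some b"
proof -
  from assms(2,4) obtain y b' where y: "(y, b') \<in> set C" "\<alpha> y = Some b'"
    by (fastforce simp: sat_assignments_def)
  have "b' = b"
  proof (rule ccontr)
    assume "b' \<noteq> b"
    with y(1) assms(3) have "(y, tag b) \<in> set L" by (auto simp: blocked_def)
    with assms(1,4) have "\<alpha> y = Some b" by (force simp: sound_def)
    with y \<open>b' \<noteq> b\<close> show False by simp
  qed
  with y that show thesis by blast
qed

lemma sound_propagate:
  assumes "double_horn \<phi>" "sound \<phi> L" "C \<in> set \<phi>"
  shows "sound \<phi> (propagate b C L)"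
proof (cases "blocked b L C")
  case False
  have "x \<in> vars \<phi> \<and> (\<forall>\<alpha>\<in>sat_assignments \<phi>. \<alpha> x = Some b)" if x: "(x, b) \<in> set C" for x
  proof
    show "x \<in> vars \<phi>" using x assms(3) by (force simp: vars_def)
    show "\<forall>\<alpha>\<in>sat_assignments \<phi>. \<alpha> x = Some b"
      using model_unblocked[OF assms(2,3) False] double_horn_unique[OF assms(1,3) x] by metis
  qed
  with assms(2) show ?thesis
    by (auto simp: propagate_def False sound_def set_heads)
qed (use assms in \<open>simp add: propagate_def\<close>)

lemma conflict_unsat:
  "sound \<phi> L \<Longrightarrow> C \<in> set \<phi> \<Longrightarrow> conflict b L C \<Longrightarrow> sat_assignments \<phi> = {}"
  unfolding conflict_def heads_eq_Nil using model_unblocked by blast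

lemma propagates_sound:
  assumes "double_horn \<phi>" "set Cs \<subseteq> set \<phi>"
  shows "propagates b Cs (L, u) = (L', u') \<Longrightarrow> sound \<phi> L \<Longrightarrow> u \<longrightarrow> sat_assignments \<phi> = {} \<Longrightarrow>
    sound \<phi> L' \<and> (u' \<longrightarrow> sat_assignments \<phi> = {})"
  using assms(2)
proof (induction Cs arbitrary: L u)
  case (Cons C Cs)
  have C: "C \<in> set \<phi>" using Cons.prems(4) by simp
  show ?case
  proof (rule Cons.IH)
    show "propagates b Cs (propagate b C L, u \<or> conflict b L C) = (L', u')" using Cons.prems(1) by simp
    show "sound \<phi> (propagate b C L)" by (rule sound_propagate[OF assms(1) Cons.prems(2) C])
    show "u \<or> conflict b L C \<longrightarrow> sat_assignments \<phi> = {}"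
      using conflict_unsat[OF Cons.prems(2) C] Cons.prems(3) by blast
  qed (use Cons.prems(4) in simp)
qed auto

lemma rounds_sound:
  assumes "double_horn \<phi>"
  shows "rounds n \<phi> (L, u) = (L', u') \<Longrightarrow> sound \<phi> L \<Longrightarrow> u \<longrightarrow> sat_assignments \<phi> = {} \<Longrightarrow>
    sound \<phi> L' \<and> (u' \<longrightarrow> sat_assignments \<phi> = {})"
proof (induction n arbitrary: L u)
  case (Suc n)
  obtain L1 u1 where 1: "propagates True \<phi> (L, u) = (L1, u1)" by force
  obtain L2 u2 where 2: "propagates False \<phi> (L1, u1) = (L2, u2)" by force
  have "sound \<phi> L1 \<and> (u1 \<longrightarrow> sat_assignments \<phi> = {})"
    by (rule propagates_sound[OF assms subset_refl 1 Suc.prems(2,3)])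
  then have "sound \<phi> L2 \<and> (u2 \<longrightarrow> sat_assignments \<phi> = {})"
    using propagates_sound[OF assms subset_refl 2] by blast
  then show ?case using Suc.prems(1) 1 2 by (intro Suc.IH[of L2 u2]) auto
qed auto

section \<open>Stabilisation after enough rounds\<close>

lemma forced_propagate:
  "forced b (propagate b C L) = forced b L \<union> (if blocked b L C then {} else {x. (x, b) \<in> set C})"
  "b' \<noteq> b \<Longrightarrow> forced b' (propagate b C L) = forced b' L"
  by (auto simp: forced_def propagate_def set_heads)

text \<open>Only entries tagged \<open>b\<close> are added, so progress and closure can be studied
  for each sign separately although the passes are interleaved.\<close>

lemma propagates_other:
  "propagates b Cs (L, u) = (L', u') \<Longrightarrow> b' \<noteq> b \<Longrightarrow> forced b' L' = forced b' L"
  by (induction Cs arbitrary: L u) (auto simp: forced_propagate(2))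

lemma propagates_mono:
  "propagates b Cs (L, u) = (L', u') \<Longrightarrow> forced b L \<subseteq> forced b L' \<and> (u \<longrightarrow> u')"
proof (induction Cs arbitrary: L u)
  case (Cons C Cs)
  from Cons.IH[of "propagate b C L" "u \<or> conflict b L C"] Cons.prems
  show ?case by (auto simp: forced_propagate(1))
qed auto

lemma rounds_mono: "rounds n \<phi> (L, u) = (L', u') \<Longrightarrow> u \<Longrightarrow> u'"
proof (induction n arbitrary: L u)
  case (Suc n)
  obtain L1 u1 where 1: "propagates True \<phi> (L, u) = (L1, u1)" by force
  obtain L2 u2 where 2: "propagates False \<phi> (L1, u1) = (L2, u2)" by force
  from propagates_mono[OF 1] propagates_mono[OF 2] Suc.prems have u2 by blast
  with Suc.IH[of L2 u2] Suc.prems 1 2 show ?case by simp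
qed auto

lemma closed_under_Cons:
  "closed_under b (forced b L) (C # Cs) \<longleftrightarrow> closed_under b (forced b L) Cs \<and>
    (\<not> blocked b L C \<longrightarrow> heads b C \<noteq> [] \<and> {x. (x, b) \<in> set C} \<subseteq> forced b L)"
proof -
  have "blocked b L C \<longleftrightarrow> \<not> (\<forall>x. (x, \<not> b) \<in> set C \<longrightarrow> x \<in> forced b L)"
    unfolding blocked_iff by blast
  moreover have "heads b C \<noteq> [] \<longleftrightarrow> (\<exists>x. (x, b) \<in> set C)"
    unfolding heads_eq_Nil by blast
  ultimately show ?thesis by (simp only: closed_under_def list.set ball_simps) blast
qed

lemma propagates_closed:
  "propagates b Cs (L, u) = (L', u') \<Longrightarrow> closed_under b (forced b L) Cs \<Longrightarrow> forced b L' = forced b L"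
proof (induction Cs arbitrary: L u)
  case (Cons C Cs)
  from Cons.prems(2) have eq: "forced b (propagate b C L) = forced b L"
    unfolding closed_under_Cons forced_propagate(1) by (cases "blocked b L C") auto
  have "forced b L' = forced b (propagate b C L)"
  proof (rule Cons.IH)
    show "propagates b Cs (propagate b C L, u \<or> conflict b L C) = (L', u')" using Cons.prems(1) by simp
    show "closed_under b (forced b (propagate b C L)) Cs"
      using Cons.prems(2) unfolding eq closed_under_Cons by (rule conjunct1)
  qed
  with eq show ?case by (simp only:)
qed simp

lemma propagates_fixpoint:
  "propagates b Cs (L, u) = (L', False) \<Longrightarrow> forced b L' = forced b L \<Longrightarrow> closed_under b (forced b L) Cs"
proof (induction Cs arbitrary: L u)
  case Nil
  then show ?case by (simp add: closed_under_def)
next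
  case (Cons C Cs)
  let ?L = "propagate b C L"
  have 1: "propagates b Cs (?L, u \<or> conflict b L C) = (L', False)" using Cons.prems by simp
  \<comment> \<open>The forced sets increase along the pass and agree at its ends, hence are
    constant throughout, so every clause is tested against the same set.\<close>
  have eq: "forced b ?L = forced b L"
    using propagates_mono[OF 1] Cons.prems(2) by (auto simp: forced_propagate(1))
  have "\<not> conflict b L C" using propagates_mono[OF 1] by blast
  moreover have "closed_under b (forced b L) Cs" using Cons.IH[OF 1] Cons.prems(2) eq by simp
  moreover have "\<not> blocked b L C \<Longrightarrow> {x. (x, b) \<in> set C} \<subseteq> forced b L"
    using eq by (auto simp: forced_propagate(1))
  ultimately show ?case
    unfolding closed_under_Cons conflict_def by blast
qed

lemma finite_forced [simp]: "finite (forced b L)"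
proof (rule finite_subset)
  show "forced b L \<subseteq> fst ` set L" by (force simp: forced_def)
qed simp

lemma propagates_progress:
  assumes "propagates b Cs (L, u) = (L', False)"
  shows "closed_under b (forced b L') Cs \<or> card (forced b L) < card (forced b L')"
proof (cases "forced b L' = forced b L")
  case True
  then show ?thesis using propagates_fixpoint[OF assms] by simp
next
  case False
  then show ?thesis using propagates_mono[OF assms] by (simp add: psubset_card_mono psubset_eq)
qed

lemma round_progress:
  assumes 1: "propagates True \<phi> (L, u) = (L1, u1)" and 2: "propagates False \<phi> (L1, u1) = (L2, False)"
  shows "closed_under b (forced b L2) \<phi> \<or> card (forced b L) < card (forced b L2)"
proof (cases b)
  case True
  have "\<not> u1" using propagates_mono[OF 2] by blast
  with propagates_progress[of True \<phi> L u L1] 1 propagates_other[OF 2, of True] True show ?thesis by simp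
next
  case False
  with propagates_progress[OF 2] propagates_other[OF 1, of False] show ?thesis by simp
qed

lemma round_closed:
  assumes 1: "propagates True \<phi> (L, u) = (L1, u1)" and 2: "propagates False \<phi> (L1, u1) = (L2, u2)"
    and "closed_under b (forced b L) \<phi>"
  shows "forced b L2 = forced b L"
proof (cases b)
  case True
  with propagates_closed[of True \<phi> L u L1] assms propagates_other[OF 2, of True] show ?thesis by simp
next
  case False
  with propagates_closed[of False \<phi> L1 u1 L2] assms propagates_other[OF 1, of False] show ?thesis by simp
qed

text \<open>A conflict-free round that does not reach closure enlarges the forced set strictly, so
  \<open>n\<close> rounds without closure force \<open>n\<close> new variables.\<close>

lemma rounds_progress:
  "rounds n \<phi> (L, u) = (L', False) \<Longrightarrow>
   closed_under b (forced b L') \<phi> \<or> n + card (forced b L) \<le> card (forced b L')"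
proof (induction n arbitrary: L u)
  case (Suc n)
  obtain L1 u1 where 1: "propagates True \<phi> (L, u) = (L1, u1)" by force
  obtain L2 u2 where 2: "propagates False \<phi> (L1, u1) = (L2, u2)" by force
  have r: "rounds n \<phi> (L2, u2) = (L', False)" using Suc.prems 1 2 by simp
  then have "\<not> u2" using rounds_mono by blast
  then have "closed_under b (forced b L2) \<phi> \<or> card (forced b L) < card (forced b L2)"
    using round_progress[OF 1] 2 by simp
  \<comment> \<open>A closed set is left unchanged by all later rounds, so closure reached early
    persists to the end.\<close>
  moreover have "closed_under b (forced b L') \<phi>" if "closed_under b (forced b L2) \<phi>"
    using that r
  proof (induction n arbitrary: L2 u2)
    case (Suc n)
    obtain L1 u1 where 1: "propagates True \<phi> (L2, u2) = (L1, u1)" by force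
    obtain L3 u3 where 2: "propagates False \<phi> (L1, u1) = (L3, u3)" by force
    from round_closed[OF 1 2 Suc.prems(1)] Suc.prems Suc.IH[of L3 u3] 1 2 show ?case by simp
  qed auto
  ultimately show ?case using Suc.IH[OF r] by auto
qed auto

section \<open>The two extreme models\<close>

definition model :: "cnf \<Rightarrow> bool \<Rightarrow> (nat \<times> nat) list \<Rightarrow> assignment" where
  "model \<phi> b L = (\<lambda>x. if x \<in> vars \<phi> then Some (x \<in> forced b L \<longleftrightarrow> b) else None)"

text \<open>If all premises of a clause are forced, closure supplies a forced head; otherwise an
  unforced premise takes the default value \<open>\<not> b\<close>, which satisfies its
  literal.\<close>

lemma model_sat:
  assumes "closed_under b (forced b L) \<phi>"
  shows "model \<phi> b L \<in> sat_assignments \<phi>"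
  unfolding sat_assignments_def
proof (intro CollectI conjI ballI)
  show "dom (model \<phi> b L) = vars \<phi>" by (auto simp: model_def dom_def)
  fix C assume C: "C \<in> set \<phi>"
  have vars: "x \<in> vars \<phi>" if "(x, b') \<in> set C" for x b' using that C by (force simp: vars_def)
  show "\<exists>(x, b')\<in>set C. model \<phi> b L x = Some b'"
  proof (cases "\<forall>x. (x, \<not> b) \<in> set C \<longrightarrow> x \<in> forced b L")
    case True
    with assms C obtain x where "(x, b) \<in> set C" "x \<in> forced b L"
      unfolding closed_under_def by blast
    with vars show ?thesis by (intro bexI[of _ "(x, b)"]) (auto simp: model_def)
  next
    case False
    then obtain x where "(x, \<not> b) \<in> set C" "x \<notin> forced b L" by blast
    with vars show ?thesis by (intro bexI[of _ "(x, \<not> b)"]) (auto simp: model_def)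
  qed
qed

section \<open>Diversity variable by variable\<close>

definition discord :: "'a list \<Rightarrow> nat" where
  "discord vs = (\<Sum>j<length vs. \<Sum>i<j. of_bool (vs ! i \<noteq> vs ! j))"

lemma finite_vars [simp]: "finite (vars \<phi>)"
  by (simp add: vars_def)

text \<open>Double counting: exchanging the sums splits the objective into one term per
  variable.\<close>

lemma diversity_discord:
  assumes "finite X"
  shows "diversity X \<alpha>s = (\<Sum>x\<in>X. discord (map (\<lambda>\<alpha>. \<alpha> x) \<alpha>s))"
proof -
  have "card (disagreement X \<alpha> \<beta>) = (\<Sum>x\<in>X. of_bool (\<alpha> x \<noteq> \<beta> x))" for \<alpha> \<beta> :: assignment
    using assms by (simp add: disagreement_def sum.If_cases of_bool_def Int_def)
  then have "diversity X \<alpha>s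
    = (\<Sum>j<length \<alpha>s. \<Sum>i<j. \<Sum>x\<in>X. of_bool ((\<alpha>s ! i) x \<noteq> (\<alpha>s ! j) x))"
    by (simp add: diversity_def)
  also have "\<dots> = (\<Sum>j<length \<alpha>s. \<Sum>x\<in>X. \<Sum>i<j. of_bool ((\<alpha>s ! i) x \<noteq> (\<alpha>s ! j) x))"
    by (intro sum.cong refl sum.swap)
  also have "\<dots> = (\<Sum>x\<in>X. \<Sum>j<length \<alpha>s. \<Sum>i<j. of_bool ((\<alpha>s ! i) x \<noteq> (\<alpha>s ! j) x))"
    by (rule sum.swap)
  finally show ?thesis by (simp add: discord_def)
qed

lemma discord_snoc: "discord (vs @ [v]) = discord vs + length (filter (\<lambda>w. w \<noteq> v) vs)"
proof -
  have "(\<Sum>i<length vs. of_bool (vs ! i \<noteq> v)) = length (filter (\<lambda>w. w \<noteq> v) vs)"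
    by (induction vs rule: rev_induct) (auto simp: nth_append)
  moreover have "(\<Sum>j<length vs. \<Sum>i<j. of_bool ((vs @ [v]) ! i \<noteq> (vs @ [v]) ! j)) = discord vs"
    unfolding discord_def by (intro sum.cong refl) (auto simp: nth_append)
  ultimately show ?thesis by (simp add: discord_def nth_append)
qed

lemma discord_const: "set vs \<subseteq> {a} \<Longrightarrow> discord vs = 0"
  by (induction vs rule: rev_induct) (auto simp: discord_snoc filter_empty_conv, simp add: discord_def)

lemma count_list_two:
  "set vs \<subseteq> {a, b} \<Longrightarrow> a \<noteq> b \<Longrightarrow> count_list vs a + count_list vs b = length vs"
  by (induction vs) auto

text \<open>A disagreeing pair of positions picks one occurrence of each of the two values.\<close>

lemma discord_two:
  assumes "a \<noteq> b"
  shows "set vs \<subseteq> {a, b} \<Longrightarrow> discord vs = count_list vs a * count_list vs b"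
proof (induction vs rule: rev_induct)
  case (snoc v vs)
  have "length (filter (\<lambda>w. w \<noteq> a) vs) = count_list vs b"
    "length (filter (\<lambda>w. w \<noteq> b) vs) = count_list vs a" if "set vs \<subseteq> {a, b}"
    using that assms by (induction vs) auto
  with snoc assms show ?case by (auto simp: discord_snoc)
qed (simp add: discord_def)

lemma length_alternate [simp]: "length (alternate k) = k"
  by (induction k rule: alternate.induct) auto

lemma count_alternate:
  "count_list (map f (alternate k)) (f True) = (k + 1) div 2"
  "count_list (map f (alternate k)) (f False) = k div 2" if "f True \<noteq> f False"
  using that by (induction k rule: alternate.induct) auto

lemma mult_le_halves: "m * n \<le> ((m + n + 1) div 2) * ((m + n) div (2 :: nat))"
proof -
  have *: "m * n \<le> ((m + n + 1) div 2) * ((m + n) div 2)" if le: "n \<le> m" for m n :: nat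
  proof -
    obtain d where d: "m = n + d" using le_Suc_ex[OF le] by blast
    define h g where "h = d div 2" and "g = (d + 1) div 2"
    have hg: "d = h + g" unfolding h_def g_def by presburger
    have halves: "(m + n) div 2 = n + h" "(m + n + 1) div 2 = n + g"
      unfolding h_def g_def d by presburger+
    \<comment> \<open>As \<open>m = n + h + g\<close>, the right side exceeds the left by exactly
      \<open>g * h\<close>.\<close>
    have "m * n \<le> (n + g) * (n + h)" unfolding d hg by (simp add: distrib_left distrib_right)
    then show ?thesis unfolding halves .
  qed
  show ?thesis
  proof (cases "n \<le> m")
    case False
    then have "n * m \<le> ((n + m + 1) div 2) * ((n + m) div 2)" by (intro *) simp
    then show ?thesis by (simp only: mult.commute[of n m] add.commute[of n m])
  qed (rule *)
qed

lemma alternate_max_diverse: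
  assumes sound: "sound \<phi> L" and closed: "\<And>b. closed_under b (forced b L) \<phi>"
  shows "max_diverse \<phi> k (map (\<lambda>b. model \<phi> b L) (alternate k))" (is "max_diverse \<phi> k ?\<alpha>s")
proof -
  have sat: "model \<phi> b L \<in> sat_assignments \<phi>" for b by (rule model_sat[OF closed])
  have "diversity (vars \<phi>) \<beta>s \<le> diversity (vars \<phi>) ?\<alpha>s"
    if \<beta>s: "length \<beta>s = k" "set \<beta>s \<subseteq> sat_assignments \<phi>" for \<beta>s
    unfolding diversity_discord[OF finite_vars]
  \<comment> \<open>The same tuple attains the maximum for every variable simultaneously, so
    comparing term by term suffices.\<close>
  proof (rule sum_mono)
    fix x assume x: "x \<in> vars \<phi>"
    let ?b = "map (\<lambda>\<beta>. \<beta> x) \<beta>s" and ?f = "\<lambda>b. model \<phi> b L x"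
    show "discord ?b \<le> discord (map (\<lambda>\<alpha>. \<alpha> x) ?\<alpha>s)"
    proof (cases "\<exists>b. x \<in> forced b L")
      case True
      then obtain b where "(x, tag b) \<in> set L" by (auto simp: forced_def)
      with sound have "\<forall>\<beta>\<in>sat_assignments \<phi>. \<beta> x = Some b" unfolding sound_def by fastforce
      with \<beta>s(2) have "set ?b \<subseteq> {Some b}" by auto
      from discord_const[OF this] show ?thesis by simp
    next
      case False
      \<comment> \<open>The model for \<open>b\<close> gives an unforced variable the value
        \<open>\<not> b\<close>, so the two models disagree on it.\<close>
      with x have f: "?f True = Some False" "?f False = Some True"
        by (simp_all add: model_def)
      have "set ?b \<subseteq> {Some True, Some False}"
      proof
        fix v assume "v \<in> set ?b"
        then obtain \<beta> where "v = \<beta> x" "\<beta> \<in> sat_assignments \<phi>" using \<beta>s(2) by auto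
        then have "dom \<beta> = vars \<phi>" by (simp add: sat_assignments_def)
        with x obtain c where "\<beta> x = Some c" by blast
        with \<open>v = \<beta> x\<close> show "v \<in> {Some True, Some False}" by (cases c) simp_all
      qed
      note two = discord_two[OF _ this] count_list_two[OF this]
      have "?f b \<in> {?f True, ?f False}" for b by (cases b) simp_all
      then have "set (map ?f (alternate k)) \<subseteq> {?f True, ?f False}" by auto
      from discord_two[OF _ this] f
      have "discord (map ?f (alternate k)) = ((k + 1) div 2) * (k div 2)"
        using count_alternate[of ?f k] by simp
      moreover have "discord ?b \<le> ((k + 1) div 2) * (k div 2)"
        using two \<beta>s(1) mult_le_halves[of "count_list ?b (Some True)" "count_list ?b (Some False)"]
        by simp
      ultimately show ?thesis by (simp add: o_def)
    qed
  qed
  moreover have "set ?\<alpha>s \<subseteq> sat_assignments \<phi>" using sat by auto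
  ultimately show ?thesis unfolding max_diverse_def by simp
qed

section \<open>From the program to the theorem\<close>

lemma reverse_cnf:
  "set (rev (map rev \<phi>)) = rev ` set \<phi>"
  "vars (rev (map rev \<phi>)) = vars \<phi>"
  "sat_assignments (rev (map rev \<phi>)) = sat_assignments \<phi>"
  "double_horn (rev (map rev \<phi>)) = double_horn \<phi>"
  by (auto simp: vars_def sat_assignments_def double_horn_def)

text \<open>The machine sees the formula backwards; the notions involved depend only on the sets of
  clauses and literals.\<close>

lemma max_diverse_reverse: "max_diverse (rev (map rev \<phi>)) = max_diverse \<phi>"
  by (intro ext) (simp only: max_diverse_def reverse_cnf)

lemma vars_concat: "vars \<phi> = fst ` set (concat \<phi>)"
  by (auto simp: vars_def)

text \<open>Each occurrence of a variable contributes at least its sign symbol, even where the name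
  is empty.\<close>

lemma card_vars: "card (vars \<phi>) \<le> length (rcnf \<phi>)"
proof -
  have "card (vars \<phi>) \<le> length (concat \<phi>)"
    unfolding vars_concat by (metis card_image_le card_length finite_set le_trans)
  also have "length C \<le> length (rlits C)" for C by (induction C) auto
  then have "length (concat \<phi>) \<le> length (rcnf \<phi>)"
    by (induction \<phi>) (auto simp: add_mono le_SucI)
  finally show ?thesis .
qed

text \<open>Soundness confines the forced variables to \<open>vars \<phi>\<close>, so more rounds
  than variables cannot all make progress.\<close>

lemma rounds_correct:
  assumes "double_horn \<phi>" "card (vars \<phi>) < n" "rounds n \<phi> ([], False) = (L, u)"
  shows "sound \<phi> L" "u \<longrightarrow> sat_assignments \<phi> = {}" "\<not> u \<longrightarrow> closed_under b (forced b L) \<phi>"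
proof -
  have "sound \<phi> []" by (simp add: sound_def)
  with rounds_sound[OF assms(1,3)] show sound: "sound \<phi> L" and "u \<longrightarrow> sat_assignments \<phi> = {}"
    by auto
  have "forced b L \<subseteq> vars \<phi>" using sound by (auto simp: forced_def sound_def)
  from card_mono[OF finite_vars this] assms(2)
  have "\<not> n + card (forced b []) \<le> card (forced b L)" by simp
  with rounds_progress[of n \<phi> "[]" False L b] assms(3)
  show "\<not> u \<longrightarrow> closed_under b (forced b L) \<phi>" by auto
qed

text \<open>With distinct variables no pair shadows another, so \<open>map_of\<close> is determined
  by the set of pairs, and neither the order nor the signs in the input matter.\<close>

lemma map_of_value:
  fixes \<phi> b L
  defines "ls \<equiv> rev (map (lit_value b L) (keep {} (concat \<phi>)))"
  shows "distinct (map fst ls)" "map_of ls = model \<phi> b L"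
proof -
  have fst: "fst \<circ> lit_value b L = fst" by (auto simp: lit_value_def)
  have keep: "distinct (map fst (keep {} (concat \<phi>)))" "fst ` set (keep {} (concat \<phi>)) = vars \<phi>"
    using distinct_keep[of "{}" "concat \<phi>"] by (simp_all add: vars_concat)
  show distinct: "distinct (map fst ls)"
    using keep(1) by (simp add: ls_def rev_map[symmetric] fst)
  have set: "set ls = (\<lambda>x. (x, x \<in> forced b L \<longleftrightarrow> b)) ` vars \<phi>"
    unfolding keep(2)[symmetric] ls_def image_image
    by (auto simp: lit_value_def forced_def image_iff Bex_def)
  show "map_of ls = model \<phi> b L"
  proof
    fix x
    show "map_of ls x = model \<phi> b L x"
    proof (cases "x \<in> vars \<phi>")
      case True
      then have "(x, x \<in> forced b L \<longleftrightarrow> b) \<in> set ls" unfolding set by blast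
      with distinct True show ?thesis by (simp add: model_def)
    next
      case False
      then have "x \<notin> fst ` set ls" unfolding set by force
      with False show ?thesis by (simp add: model_def map_of_eq_None_iff)
    qed
  qed
qed

lemma wp_main_correct:
  assumes "double_horn \<phi>" "k \<ge> 1"
  shows "wp (bound (length (enc_instance \<phi> k))) main
    (\<lambda>s. correct_output \<phi> k (hd s) \<and> 0 \<notin> set (hd s))
    (enc_instance \<phi> k # replicate (14 - 1) [])"
proof -
  define N where "N = length (enc_instance \<phi> k)"
  define Cs where "Cs = rev (map rev \<phi>)"
  obtain L u where r: "rounds N Cs ([], False) = (L, u)" by force
  have dh: "double_horn Cs" using assms(1) by (simp add: Cs_def reverse_cnf)
  have "N = length (rcnf Cs) + k"
    by (simp add: N_def enc_instance_def Cs_def flip: rev_enc_cnf)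
  \<comment> \<open>The inequality is strict because \<open>k \<ge> 1\<close> contributes a tally
    mark to the input.\<close>
  then have "card (vars Cs) < N" using card_vars[of Cs] assms(2) by simp
  note correct = rounds_correct[OF dh this r]
  have sat: "sat_assignments Cs = sat_assignments \<phi>" by (simp add: Cs_def reverse_cnf)
  have seen: "seen L = {}" using correct(1) by (auto simp: seen_def sound_def)
  show ?thesis unfolding N_def[symmetric]
  proof (simp add: numeral_eq_Suc, rule wp_main[OF N_def Cs_def r seen])
    fix s L'
    assume u: "\<not> u" and L': "\<forall>x b. (x, tag b) \<in> set L' \<longleftrightarrow> (x, tag b) \<in> set L"
      and s: "hd s = enc_cnf (map (\<lambda>b. rev (map (lit_value b L') (keep {} (concat Cs)))) (alternate k))"
    \<comment> \<open>Deduplication adds only marks with tag 5, which the models do not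
      consult.\<close>
    have forced: "forced b L' = forced b L" for b using L' by (simp add: forced_def)
    have model: "model Cs b L' = model Cs b L" for b unfolding model_def forced ..
    have closed: "closed_under b (forced b L) Cs" for b using correct(3) u by blast
    then have "sat_assignments \<phi> \<noteq> {}" using model_sat sat by blast
    moreover have "enc_assignments (hd s) (map (\<lambda>b. model Cs b L) (alternate k))"
      unfolding enc_assignments_def s
      by (rule exI, rule conjI[OF refl]) (auto simp: map_of_value model o_def)
    moreover have "max_diverse \<phi> k (map (\<lambda>b. model Cs b L) (alternate k))"
      using alternate_max_diverse[OF correct(1) closed] by (simp add: Cs_def max_diverse_reverse)
    ultimately show "correct_output \<phi> k (hd s) \<and> 0 \<notin> set (hd s)"
      using s by (auto simp: correct_output_def)
  next
    fix s :: "nat list list" assume "u" "hd s = [7]"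
    with correct(2) sat show "correct_output \<phi> k (hd s) \<and> 0 \<notin> set (hd s)"
      by (simp add: correct_output_def unsat_report_def)
  qed
qed

lemma wf_main: "wf_com 14 8 main"
  by (simp add: main_def read_loop_def mv_def drop_all_def rounds_loop_def pass_def pass_loop_def
      clause_step_def scan_clause_def lit_step_def getvar_def lookup_def lookup_loop_def compare_def
      set_flag_def tag_def dedup_def dedup_loop_def write_loop_def write_model_def emit_loop_def emit_def)

lemma set_enc_instance: "set (enc_instance \<phi> k) \<subseteq> {1..<8}"
  by (auto simp: enc_instance_def enc_cnf_def enc_literals_def enc_literal_def
      dest!: enc_nat_digit split: if_splits)

theorem theorem7:
  "\<exists>(M :: tm) (p :: nat poly). turing_machine M \<and>
     (\<forall>(\<phi> :: cnf) (k :: nat). double_horn \<phi> \<and> k \<ge> 1 \<longrightarrow>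
        (\<exists>v. computes_within M (enc_instance \<phi> k) (poly p (length (enc_instance \<phi> k))) v \<and>
             correct_output \<phi> k v))"
proof (intro exI[of _ "machine 14 8 main"] exI[of _ "pcompose (time main) [:0, 2, 2:]"] conjI allI impI)
  show "turing_machine (machine 14 8 main)"
    by (rule turing_machine_machine[OF wf_main]) simp_all
  fix \<phi> :: cnf and k :: nat assume "double_horn \<phi> \<and> k \<ge> 1"
  then obtain s where s: "ev (bound (length (enc_instance \<phi> k))) main
      (enc_instance \<phi> k # replicate (14 - 1) []) s" "correct_output \<phi> k (hd s)" "0 \<notin> set (hd s)"
    using wp_main_correct[of \<phi> k] unfolding wp_def by blast
  have "computes_within (machine 14 8 main) (enc_instance \<phi> k)
      (poly (pcompose (time main) [:0, 2, 2:]) (length (enc_instance \<phi> k))) (hd s)"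
  proof (rule computes_within_machine[OF _ wf_main])
    show "wp (bound (length (enc_instance \<phi> k))) main (\<lambda>s'. hd s' = hd s)
        (enc_instance \<phi> k # replicate (14 - 1) [])"
      using s(1) unfolding wp_def by blast
    \<comment> \<open>The witness polynomial substitutes the bound \<open>2 * N * N + 2 * N\<close>
      on the stacks into the running time.\<close>
    have "bound N = poly [:0, 2, 2:] N" for N by (simp add: bound_def algebra_simps)
    then show "poly (time main) (bound (length (enc_instance \<phi> k)))
        \<le> poly (pcompose (time main) [:0, 2, 2:]) (length (enc_instance \<phi> k))"
      by (simp only: poly_pcompose order_refl)
  qed (use s set_enc_instance in auto)
  with s(2) show "\<exists>v. computes_within (machine 14 8 main) (enc_instance \<phi> k)
      (poly (pcompose (time main) [:0, 2, 2:]) (length (enc_instance \<phi> k))) v \<and>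
      correct_output \<phi> k v" by blast
qed

end
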